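(* $\mathbf{PQSym}^{(\ell)}$, with its product and with the coproduct $\Delta$ defined by $\Delta f(\boldsymbol{A})=f(\boldsymbol{A}'\oplus\boldsymbol{A}'')$, is a graded connected bialgebra, hence a Hopf algebra. More precisely, the coproduct can be computed in the following way: $$\Delta\mathbf{G}_{(\mathbf{a},u)}=\sum_{\substack{(\mathbf{a}',\mathbf{a}'',u',u'')\\ (\mathbf{a},u)\in(\mathbf{a}',u')\Cup(\mathbf{a}'',u'')}}\mathbf{G}_{(\mathbf{a}',u')}\otimes\mathbf{G}_{(\mathbf{a}'',u'')}.$$
   Context: A parking function of length $n$ is a word $\mathbf{a}=a_1\cdots a_n$ on $\{1,\ldots,n\}$ whose nondecreasing rearrangement $a_1'\cdots a_n'$ satisfies $a_i'\le i$ for all $i$. A colored parking function of level $\ell$ and size $n$ is a pair $(\mathbf{a},u)$ of a parking function $\mathbf{a}$ of length $n$ and a word $u$ of length $n$ over a set $C$ of $\ell$ colors. Parkization: for a word $w=w_1\cdots w_n$ of positive integers let $d(w)=\min\{i:\#\{j:w_j\le i\}<i\}$. If $d(w)=n+1$, then $w$ is a parking function and $\mathrm{Park}(w)=w$. Otherwise let $w'$ be obtained from $w$ by decreasing by $1$ all the letters greater than $d(w)$, and set $\mathrm{Park}(w)=\mathrm{Park}(w')$. The colored parkization of a colored word $(w,u)$ is $(\mathrm{Park}(w),u)$. $\mathbf{PQSym}^{(\ell)}$ is the algebra with linear basis $\mathbf{G}_{(\mathbf{a},u)}$ indexed by all colored parking functions of level $\ell$ (including the empty one), graded by size, with product $$\mathbf{G}_{(\mathbf{a}',u')}\mathbf{G}_{(\mathbf{a}'',u'')}=\sum_{\mathbf{a}\in\mathbf{a}'*\mathbf{a}''}\mathbf{G}_{(\mathbf{a},u'\cdot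 u'')}.$$ Here $u'\cdot u''$ is the concatenation of color words, and the convolution $\mathbf{a}'*\mathbf{a}''$ is the set of all parking functions $\mathbf{a}=v\cdot w$ (concatenation) with $\mathrm{Park}(v)=\mathbf{a}'$ and $\mathrm{Park}(w)=\mathbf{a}''$. It is realized on the colored alphabet $\boldsymbol{A}=A\times C$, with $A=\{1,2,\ldots\}$ totally ordered, $\mathbf{G}_{(\mathbf{a},u)}=\mathbf{G}_{(\mathbf{a},u)}(\boldsymbol{A})$ being the sum of all colored words over $\boldsymbol{A}$ whose colored parkization is $(\mathbf{a},u)$. Coproduct: only the total order on $A$ is used to define the colored parkization. Taking two isomorphic copies $A'$ and $A''$ of $A$, set $\boldsymbol{A}'=A'\times C$, $\boldsymbol{A}''=A''\times C$ and $\boldsymbol{A}'\oplus\boldsymbol{A}''=(A'\oplus A'')\times C$, where $A'\oplus A''$ is the ordered sum. Assuming that $\boldsymbol{A}'$ and $\boldsymbol{A}''$ commute, $f(\boldsymbol{A}')g(\boldsymbol{A}'')$ is identified with $f\otimes g$, and $\Delta f(\boldsymbol{A})=f(\boldsymbol{A}'\oplus\boldsymbol{A}'')$. The shifted shuffle $(\mathbf{a}',u')\Cup(\mathbf{a}'',u'')$ is the shuffle of the words of biletters $(\mathbf{a}',u')$ and $(\mathbf{a}''[k],u'')$, where $k$ is the length of $\mathbf{a}'$ and $\mathbf{a}''[k]$ is $\mathbf{a}''$ with $k$ added to each letter (colors follow their letters). *)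

theory Defs
  imports Complex_Main "HOL-Library.Poly_Mapping"
begin

section \<open>Free vector spaces, their tensor products, bialgebras\<close>

text \<open>The vector space with linear basis \<open>'b\<close> over a field \<open>'k\<close> is the type \<open>'b \<Rightarrow>\<^sub>0 'k\<close> of finitely
  supported functions.  The tensor product of the spaces with bases \<open>'a\<close> and \<open>'b\<close> is the space with
  basis \<open>'a \<times> 'b\<close>.\<close>

abbreviation lookup :: "('b \<Rightarrow>\<^sub>0 'k::zero) \<Rightarrow> 'b \<Rightarrow> 'k" where
  "lookup \<equiv> Poly_Mapping.lookup"

abbreviation keys :: "('b \<Rightarrow>\<^sub>0 'k::zero) \<Rightarrow> 'b set" where
  "keys \<equiv> Poly_Mapping.keys"

definition scale :: "'k::field \<Rightarrow> ('b \<Rightarrow>\<^sub>0 'k) \<Rightarrow> ('b \<Rightarrow>\<^sub>0 'k)" where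
  "scale c x = Poly_Mapping.map ((*) c) x"

lemma lookup_scale: "lookup (scale c x) b = c * lookup x b"
  by (cases "lookup x b = 0") (simp_all add: scale_def Poly_Mapping.map.rep_eq)

lemma vector_space_scale: "vector_space (scale :: 'k::field \<Rightarrow> ('b \<Rightarrow>\<^sub>0 'k) \<Rightarrow> _)"
  by unfold_locales
     (auto intro!: poly_mapping_eqI simp: lookup_scale lookup_add algebra_simps)

abbreviation bas :: "'b \<Rightarrow> ('b \<Rightarrow>\<^sub>0 'k::field)" where
  "bas b \<equiv> Poly_Mapping.single b 1"

definition lin_ext :: "('a \<Rightarrow> ('b \<Rightarrow>\<^sub>0 'k)) \<Rightarrow> ('a \<Rightarrow>\<^sub>0 'k) \<Rightarrow> ('b \<Rightarrow>\<^sub>0 'k::field)" where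
  "lin_ext \<phi> x = (\<Sum>a\<in>keys x. scale (lookup x a) (\<phi> a))"

definition tensor :: "('a \<Rightarrow>\<^sub>0 'k) \<Rightarrow> ('b \<Rightarrow>\<^sub>0 'k) \<Rightarrow> ('a \<times> 'b \<Rightarrow>\<^sub>0 'k::field)"  (infixr "\<otimes>" 72) where
  "x \<otimes> y = (\<Sum>a\<in>keys x. \<Sum>b\<in>keys y. Poly_Mapping.single (a, b) (lookup x a * lookup y b))"

definition tensor_map ::
    "(('a \<Rightarrow>\<^sub>0 'k) \<Rightarrow> ('c \<Rightarrow>\<^sub>0 'k)) \<Rightarrow> (('b \<Rightarrow>\<^sub>0 'k) \<Rightarrow> ('d \<Rightarrow>\<^sub>0 'k))
      \<Rightarrow> ('a \<times> 'b \<Rightarrow>\<^sub>0 'k) \<Rightarrow> ('c \<times> 'd \<Rightarrow>\<^sub>0 'k::field)" where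
  "tensor_map f g = lin_ext (\<lambda>(a, b). f (bas a) \<otimes> g (bas b))"

definition tensor_assoc :: "(('a \<times> 'b) \<times> 'c \<Rightarrow>\<^sub>0 'k) \<Rightarrow> ('a \<times> ('b \<times> 'c) \<Rightarrow>\<^sub>0 'k::field)" where
  "tensor_assoc = lin_ext (\<lambda>((a, b), c). bas (a, (b, c)))"

text \<open>The product of the tensor square of an algebra,
  \<open>(x \<otimes> y) (x' \<otimes> y') = x x' \<otimes> y y'\<close>.\<close>

definition tensor_mult ::
    "(('b \<Rightarrow>\<^sub>0 'k) \<Rightarrow> ('b \<Rightarrow>\<^sub>0 'k) \<Rightarrow> ('b \<Rightarrow>\<^sub>0 'k))
      \<Rightarrow> ('b \<times> 'b \<Rightarrow>\<^sub>0 'k) \<Rightarrow> ('b \<times> 'b \<Rightarrow>\<^sub>0 'k) \<Rightarrow> ('b \<times> 'b \<Rightarrow>\<^sub>0 'k::field)" where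
  "tensor_mult mult s t =
     (\<Sum>(a, b)\<in>keys s. \<Sum>(c, d)\<in>keys t.
        scale (lookup s (a, b) * lookup t (c, d)) (mult (bas a) (bas c) \<otimes> mult (bas b) (bas d)))"

locale unital_algebra =
  fixes mult :: "('b \<Rightarrow>\<^sub>0 'k::field) \<Rightarrow> ('b \<Rightarrow>\<^sub>0 'k) \<Rightarrow> ('b \<Rightarrow>\<^sub>0 'k)"
    and one :: "'b \<Rightarrow>\<^sub>0 'k"
  assumes mult_linear_left: "Vector_Spaces.linear scale scale (\<lambda>x. mult x y)"
    and mult_linear_right: "Vector_Spaces.linear scale scale (\<lambda>y. mult x y)"
    and mult_assoc: "mult (mult x y) z = mult x (mult y z)"
    and mult_one_left: "mult one x = x"
    and mult_one_right: "mult x one = x"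

locale counital_coalgebra =
  fixes comult :: "('b \<Rightarrow>\<^sub>0 'k::field) \<Rightarrow> ('b \<times> 'b \<Rightarrow>\<^sub>0 'k)"
    and counit :: "('b \<Rightarrow>\<^sub>0 'k) \<Rightarrow> 'k"
  assumes comult_linear: "Vector_Spaces.linear scale scale comult"
    and counit_linear: "Vector_Spaces.linear scale (*) counit"
    and comult_coassoc:
      "tensor_assoc (tensor_map comult id (comult x)) = tensor_map id comult (comult x)"
    and counit_left: "lin_ext (\<lambda>(a, b). scale (counit (bas a)) (bas b)) (comult x) = x"
    and counit_right: "lin_ext (\<lambda>(a, b). scale (counit (bas b)) (bas a)) (comult x) = x"

locale bialgebra =
  unital_algebra mult one + counital_coalgebra comult counit
  for mult :: "('b \<Rightarrow>\<^sub>0 'k::field) \<Rightarrow> ('b \<Rightarrow>\<^sub>0 'k) \<Rightarrow> ('b \<Rightarrow>\<^sub>0 'k)" and one comult counit +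
  assumes comult_mult: "comult (mult x y) = tensor_mult mult (comult x) (comult y)"
    and comult_one: "comult one = one \<otimes> one"
    and counit_mult: "counit (mult x y) = counit x * counit y"
    and counit_one: "counit one = 1"

locale graded_connected_bialgebra =
  bialgebra mult one comult counit
  for mult :: "('b \<Rightarrow>\<^sub>0 'k::field) \<Rightarrow> ('b \<Rightarrow>\<^sub>0 'k) \<Rightarrow> ('b \<Rightarrow>\<^sub>0 'k)" and one comult counit +
  fixes V :: "nat \<Rightarrow> ('b \<Rightarrow>\<^sub>0 'k) set"
  assumes component_subspace: "module.subspace scale (V n)"
    and direct_sum:
      "\<exists>!c. finite {n. c n \<noteq> 0} \<and> (\<forall>n. c n \<in> V n) \<and> x = (\<Sum>n | c n \<noteq> 0. c n)"
    and graded_mult: "x \<in> V m \<Longrightarrow> y \<in> V n \<Longrightarrow> mult x y \<in> V (m + n)"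
    and graded_one: "one \<in> V 0"
    and graded_comult:
      "x \<in> V n \<Longrightarrow> comult x \<in> module.span scale {y \<otimes> z | y z i j. i + j = n \<and> y \<in> V i \<and> z \<in> V j}"
    and graded_counit: "x \<in> V n \<Longrightarrow> n \<noteq> 0 \<Longrightarrow> counit x = 0"
    and connected: "V 0 = module.span scale {one}"

locale hopf_algebra =
  bialgebra mult one comult counit
  for mult :: "('b \<Rightarrow>\<^sub>0 'k::field) \<Rightarrow> ('b \<Rightarrow>\<^sub>0 'k) \<Rightarrow> ('b \<Rightarrow>\<^sub>0 'k)" and one comult counit +
  assumes antipode: "\<exists>S. Vector_Spaces.linear scale scale S \<and>
      (\<forall>x. lin_ext (\<lambda>(a, b). mult (S (bas a)) (bas b)) (comult x) = scale (counit x) one) \<and>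
      (\<forall>x. lin_ext (\<lambda>(a, b). mult (bas a) (S (bas b))) (comult x) = scale (counit x) one)"


section \<open>Parking functions and parkization\<close>

definition parking :: "nat list \<Rightarrow> bool" where
  "parking a \<longleftrightarrow> set a \<subseteq> {1..length a} \<and> (\<forall>i<length a. sort a ! i \<le> i + 1)"

definition defect :: "nat list \<Rightarrow> nat" where
  "defect w = (LEAST i. length (filter (\<lambda>x. x \<le> i) w) < i)"

lemma defect_prop: "length (filter (\<lambda>x. x \<le> defect w) w) < defect w"
  unfolding defect_def
  by (rule LeastI[of _ "Suc (length w)"]) (simp add: le_imp_less_Suc)

lemma defect_le: "defect w \<le> Suc (length w)"
  unfolding defect_def by (rule Least_le) (simp add: le_imp_less_Suc)

lemma below_defect: "i < defect w \<Longrightarrow> i \<le> length (filter (\<lambda>x. x \<le> i) w)"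
  unfolding defect_def using not_less_Least by fastforce

function park :: "nat list \<Rightarrow> nat list" where
  "park w = (if defect w = length w + 1 then w
             else park (map (\<lambda>x. if x > defect w then x - 1 else x) w))"
  by pat_completeness auto

lemma sum_list_decr:
  fixes w :: "nat list"
  shows "x \<in> set w \<Longrightarrow> x > d \<Longrightarrow> sum_list (map (\<lambda>x. if x > d then x - 1 else x) w) < sum_list w"
proof (induction w)
  case (Cons y w)
  have "sum_list (map (\<lambda>x. if x > d then x - 1 else x) w) \<le> sum_list (map (\<lambda>x. x) w)"
    by (rule sum_list_mono) auto
  with Cons show ?case by auto
qed simp

termination park
proof (relation "measure sum_list")
  fix w :: "nat list"
  assume "defect w \<noteq> length w + 1"
  with defect_le[of w] have "defect w \<le> length w" by simp
  with defect_prop[of w] have "filter (\<lambda>x. x \<le> defect w) w \<noteq> w" by auto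
  then obtain x where "x \<in> set w" "x > defect w"
    by (auto simp: filter_id_conv not_le)
  from sum_list_decr[OF this]
  show "(map (\<lambda>x. if x > defect w then x - 1 else x) w, w) \<in> measure sum_list" by simp
qed simp

declare park.simps [simp del]

text \<open>Parkization over an alphabet \<open>S\<close> totally ordered by \<open>lt\<close>, as needed for the ordered sum of two
  copies of \<open>{1, 2, \<dots>}\<close>, where the recursion of \<^const>\<open>park\<close> makes no sense: there is no predecessor for
  the first letter of the second copy.  One step of \<^const>\<open>park\<close> erases an unused letter of the
  alphabet (the \<open>d\<close>-th one), and the process stops when every letter \<open>x\<close> of \<open>w\<close> is at most the place
  it gets counting from any \<open>y \<le> x\<close> occurring in \<open>w\<close>: one more than the number of letters of \<open>w\<close> smaller
  than \<open>y\<close>, plus the distance from \<open>y\<close> to \<open>x\<close> in the alphabet.  The final place of \<open>x\<close> is the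
  least of these; letters \<open>y\<close> at infinite distance impose no bound.  The lemmas \<open>park_on_nat\<close>
  and \<open>park_on_sum\<close> below show that this is \<^const>\<open>park\<close> on \<open>{1, 2, \<dots>}\<close>, and on the ordered sum
  the parkization in \<open>{1, \<dots>, N} \<oplus> A''\<close> (isomorphic to \<open>{1, 2, \<dots>}\<close>) for all large \<open>N\<close>.\<close>

definition park_place :: "'a set \<Rightarrow> ('a \<Rightarrow> 'a \<Rightarrow> bool) \<Rightarrow> 'a list \<Rightarrow> 'a \<Rightarrow> nat" where
  "park_place S lt w x =
     Min {1 + length (filter (\<lambda>z. lt z y) w) + card {z \<in> S. \<not> lt z y \<and> lt z x} | y.
            y \<in> set w \<and> \<not> lt x y \<and> finite {z \<in> S. \<not> lt z y \<and> lt z x}}"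

definition park_on :: "'a set \<Rightarrow> ('a \<Rightarrow> 'a \<Rightarrow> bool) \<Rightarrow> 'a list \<Rightarrow> nat list" where
  "park_on S lt w = map (park_place S lt w) w"

fun osum_less :: "nat + nat \<Rightarrow> nat + nat \<Rightarrow> bool" where
  "osum_less (Inl i) (Inl j) \<longleftrightarrow> i < j"
| "osum_less (Inl i) (Inr j) \<longleftrightarrow> True"
| "osum_less (Inr i) (Inl j) \<longleftrightarrow> False"
| "osum_less (Inr i) (Inr j) \<longleftrightarrow> i < j"

lemma Min_image_eqI:
  fixes f g :: "'a \<Rightarrow> nat"
  assumes "finite A" "A \<noteq> {}" "finite B" "B \<noteq> {}"
    and "\<And>a. a \<in> A \<Longrightarrow> \<exists>b\<in>B. g b \<le> f a" "\<And>b. b \<in> B \<Longrightarrow> \<exists>a\<in>A. f a \<le> g b"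
  shows "Min (f ` A) = Min (g ` B)"
proof (rule antisym)
  show "Min (f ` A) \<le> Min (g ` B)"
    using assms by (auto simp: Min_le_iff)
  show "Min (g ` B) \<le> Min (f ` A)"
    using assms by (auto simp: Min_le_iff)
qed

lemma park_place_nat:
  assumes "set w \<subseteq> {1..}"
  shows "park_place {1..} (<) w x =
    Min ((\<lambda>y. 1 + length (filter (\<lambda>z. z < y) w) + (x - y)) ` {y \<in> set w. y \<le> x})"
proof -
  have "{z \<in> {1..}. \<not> z < y \<and> z < x} = {y..<x}" if "y \<in> set w" for y
    using that assms by (auto simp: subset_eq)
  hence "{1 + length (filter (\<lambda>z. z < y) w) + card {z \<in> {1..}. \<not> z < y \<and> z < x} | y.
            y \<in> set w \<and> \<not> x < y \<and> finite {z \<in> {1..}. \<not> z < y \<and> z < x}} =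
        {1 + length (filter (\<lambda>z. z < y) w) + (x - y) | y. y \<in> set w \<and> y \<le> x}"
    by (intro Collect_cong ex_cong1) (auto simp: not_less)
  also have "\<dots> = (\<lambda>y. 1 + length (filter (\<lambda>z. z < y) w) + (x - y)) ` {y \<in> set w. y \<le> x}"
    by blast
  finally show ?thesis unfolding park_place_def by simp
qed

lemma less_filter: "y > 0 \<Longrightarrow> filter (\<lambda>z. z < y) w = filter (\<lambda>z. z \<le> y - Suc 0) w" for y :: nat
  by (rule filter_cong) auto

lemma below_letter: "1 \<le> y \<Longrightarrow> y \<le> defect w \<Longrightarrow> y \<le> 1 + length (filter (\<lambda>z. z < y) w)"
  using below_defect[of "y - 1" w] by (cases y) (simp_all add: less_filter)

lemma defect_count:
  assumes "set w \<subseteq> {1..}" "y > defect w" "\<And>z. z \<in> set w \<Longrightarrow> z > defect w \<Longrightarrow> y \<le> z"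
  shows "1 + length (filter (\<lambda>z. z < y) w) \<le> defect w"
proof -
  have "filter (\<lambda>z. z < y) w = filter (\<lambda>z. z \<le> defect w) w"
    using assms by (intro filter_cong) (auto simp: not_le[symmetric])
  thus ?thesis using defect_prop[of w] by simp
qed

lemma defect_notin:
  assumes "set w \<subseteq> {1..}" "x \<in> set w" shows "x \<noteq> defect w"
proof
  assume x: "x = defect w"
  have "length (filter (\<lambda>z. z < x) w) < length (filter (\<lambda>z. z \<le> x) w)"
    using assms(2)
  proof (induction w)
    case (Cons a w)
    have "length (filter (\<lambda>z. z < x) w) \<le> length (filter (\<lambda>z. z \<le> x) w)"
      by (induction w) auto
    with Cons show ?case by auto
  qed simp
  moreover have "1 \<le> x" using assms by auto
  ultimately show False
    using below_letter[of x w] defect_prop[of w] x by simp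
qed

lemma park_place_fix:
  assumes w: "set w \<subseteq> {1..}" and d: "defect w = length w + 1" and x: "x \<in> set w"
  shows "park_place {1..} (<) w x = x"
proof -
  have len: "filter (\<lambda>z. z \<le> length w) w = w"
    using below_defect[of "length w" w] d by (metis length_filter_le le_antisym
        length_filter_less less_irrefl filter_True lessI Suc_eq_plus1)
  hence le: "z \<le> length w" if "z \<in> set w" for z
    using that len by (simp add: filter_id_conv)
  have "length (filter (\<lambda>z. z \<le> 1) w) \<ge> 1"
    using below_defect[of 1 w] d x by (cases w) auto
  hence "filter (\<lambda>z. z \<le> 1) w \<noteq> []" by auto
  then obtain o1 where "o1 \<in> set w" "o1 \<le> 1" by (auto simp: filter_empty_conv)
  with w have 1: "1 \<in> set w" by (metis atLeast_iff le_antisym subsetD)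
  have x1: "x \<ge> 1" using w x by auto
  have no: "filter (\<lambda>z. z < 1) w = []" using w by (auto simp: filter_empty_conv)
  show ?thesis unfolding park_place_nat[OF w]
  proof (rule Min_eqI)
    show "x \<in> (\<lambda>y. 1 + length (filter (\<lambda>z. z < y) w) + (x - y)) ` {y \<in> set w. y \<le> x}"
      using 1 x1 no by (intro image_eqI[of _ _ 1]) auto
  next
    fix v assume "v \<in> (\<lambda>y. 1 + length (filter (\<lambda>z. z < y) w) + (x - y)) ` {y \<in> set w. y \<le> x}"
    then obtain y where y: "y \<in> set w" "y \<le> x" "v = 1 + length (filter (\<lambda>z. z < y) w) + (x - y)"
      by auto
    have "1 \<le> y" using y w by auto
    with below_letter[of y w] le[OF y(1)] d y show "x \<le> v" by simp
  qed simp
qed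

lemma park_place_step:
  assumes w: "set w \<subseteq> {1..}" and x: "x \<in> set w"
  defines "g \<equiv> (\<lambda>z. if z > defect w then z - 1 else z)"
  shows "park_place {1..} (<) (map g w) (g x) = park_place {1..} (<) w x"
proof -
  let ?d = "defect w"
  let ?n = "\<lambda>y. length (filter (\<lambda>z. z < y) w)"
  let ?Y = "{y \<in> set w. y \<le> x}"
  have nd: "z \<noteq> ?d" if "z \<in> set w" for z using defect_notin[OF w that] .
  have lt: "g y < g z \<longleftrightarrow> y < z" if "y \<in> set w" "z \<in> set w" for y z
    using nd[OF that(1)] nd[OF that(2)] by (auto simp: g_def)
  have w': "set (map g w) \<subseteq> {1..}"
    using w defect_prop[of w] by (auto simp: g_def subset_eq)
  have Y: "{y \<in> set (map g w). y \<le> g x} = g ` ?Y"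
    using lt x by (auto simp: not_less[symmetric])
  have cnt: "length (filter (\<lambda>z. z < g y) (map g w)) = ?n y" if "y \<in> set w" for y
    using that lt by (simp add: filter_map o_def cong: filter_cong)
  have "park_place {1..} (<) (map g w) (g x) = Min ((\<lambda>y. 1 + ?n y + (g x - g y)) ` ?Y)"
    unfolding park_place_nat[OF w'] Y image_image
    by (rule arg_cong[of _ _ Min], rule image_cong[OF refl]) (subst cnt, auto)
  also have "\<dots> = Min ((\<lambda>y. 1 + ?n y + (x - y)) ` ?Y)"
  proof (cases "x > ?d")
    case False
    hence "g y = y" if "y \<le> x" for y using that by (auto simp: g_def)
    thus ?thesis by (intro arg_cong[of _ _ Min] image_cong) auto
  next
    case True
    let ?m = "Min {y \<in> set w. y > ?d}"
    have m: "?m \<in> {y \<in> set w. y > ?d}" using True x by (intro Min_in) auto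
    have mle: "?m \<le> z" if "z \<in> set w" "z > ?d" for z using that by (intro Min_le) auto
    have mx: "?m \<le> x" using mle x True by auto
    have nm: "1 + ?n ?m \<le> ?d" using m by (intro defect_count[OF w]) (auto intro: mle)
    have small: "1 + ?n ?m + (x - ?m) \<le> 1 + ?n y + (g x - g y)"
      if "y \<in> ?Y" "y < ?d" for y
    proof -
      have "y \<le> 1 + ?n y" using that w by (intro below_letter) auto
      thus ?thesis using that nm m mx True by (auto simp: g_def)
    qed
    show ?thesis
    proof (rule Min_image_eqI)
      fix y assume y: "y \<in> ?Y"
      show "\<exists>b\<in>?Y. 1 + ?n b + (x - b) \<le> 1 + ?n y + (g x - g y)"
      proof (cases "y < ?d")
        case True
        with small[OF y] m mx show ?thesis by (intro bexI[of _ ?m]) auto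
      next
        case False
        with nd y True show ?thesis
          by (intro bexI[of _ y]) (auto simp: g_def nat_neq_iff)
      qed
    next
      fix y assume y: "y \<in> ?Y"
      show "\<exists>a\<in>?Y. 1 + ?n a + (g x - g a) \<le> 1 + ?n y + (x - y)"
        using y True by (intro bexI[of _ y]) (auto simp: g_def)
    qed (use x in auto)
  qed
  finally show ?thesis unfolding park_place_nat[OF w] .
qed

lemma park_on_nat: "set w \<subseteq> {1..} \<Longrightarrow> park_on {1..} (<) w = park w"
proof (induction w rule: park.induct)
  case (1 w)
  show ?case
  proof (cases "defect w = length w + 1")
    case True
    hence "map (park_place {1..} (<) w) w = map id w"
      using park_place_fix[OF 1(2)] by (intro map_cong) auto
    thus ?thesis using True by (simp add: park_on_def park.simps[of w])
  next
    case False
    let ?g = "\<lambda>z. if z > defect w then z - 1 else z"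
    have "set (map ?g w) \<subseteq> {1..}"
      using 1(2) defect_prop[of w] by (auto simp: subset_eq)
    hence "park_on {1..} (<) (map ?g w) = park w"
      using 1(1)[OF False] False by (simp add: park.simps[of w])
    moreover have "park_on {1..} (<) (map ?g w) = park_on {1..} (<) w"
      using park_place_step[OF 1(2)] unfolding park_on_def map_map
      by (intro map_cong) auto
    ultimately show ?thesis by simp
  qed
qed

lemma park_on_sum:
  assumes w: "set w \<subseteq> {1..} <+> {1..}"
  shows "\<forall>\<^sub>F N in sequentially.
    park_on ({1..} <+> {1..}) osum_less w = park (map (case_sum id (\<lambda>j. N + j)) w)"
proof -
  define M where "M = Max (insert 0 (Inl -` set w))"
  have fin: "finite (Inl -` set w)" by (rule finite_vimageI) auto
  have M: "i \<le> M" if "Inl i \<in> set w" for i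
    unfolding M_def using that fin by (intro Max_ge) auto
  have "park_on ({1..} <+> {1..}) osum_less w = park (map (case_sum id (\<lambda>j. N + j)) w)"
    if N: "N \<ge> M + length w" for N
  proof -
    let ?e = "case_sum id (\<lambda>j. N + j)"
    let ?S = "{1..} <+> {1..} :: (nat + nat) set"
    let ?n = "\<lambda>y. length (filter (\<lambda>z. osum_less z y) w)"
    have lt: "?e y < ?e z \<longleftrightarrow> osum_less y z" if "y \<in> set w" "z \<in> set w" for y z
      using that w N M by (cases y; cases z) (fastforce simp: subset_eq)+
    have w': "set (map ?e w) \<subseteq> {1..}"
      using w by (fastforce simp: subset_eq)
    have "park_place {1..} (<) (map ?e w) (?e x) = park_place ?S osum_less w x"
      if x: "x \<in> set w" for x
    proof -
      let ?Y = "{y \<in> set w. \<not> osum_less x y}"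
      let ?F = "\<lambda>y. {z \<in> ?S. \<not> osum_less z y \<and> osum_less z x}"
      have Y: "{y \<in> set (map ?e w). y \<le> ?e x} = ?e ` ?Y"
        using lt x by (auto simp: not_less[symmetric])
      have cnt: "length (filter (\<lambda>z. z < ?e y) (map ?e w)) = ?n y" if "y \<in> set w" for y
        using that lt by (simp add: filter_map o_def cong: filter_cong)
      have Fl: "?F (Inl i) = Inl ` {i..<j}" if "x = Inl j" "i \<ge> 1" for i j
        using that by (auto simp: image_iff elim!: PlusE)
      have Fr: "?F (Inr i) = Inr ` {i..<j}" if "x = Inr j" "i \<ge> 1" for i j
        using that by (auto simp: image_iff elim!: PlusE)
      have Finf: "infinite (?F (Inl i))" if "x = Inr j" "i \<ge> 1" for i j
      proof
        assume "finite (?F (Inl i))"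
        moreover have "Inl ` {i..} \<subseteq> ?F (Inl i)" using that by auto
        ultimately have "finite (Inl ` {i..} :: (nat + nat) set)" by (rule rev_finite_subset)
        hence "finite {i..}" by (subst (asm) finite_image_iff) auto
        thus False using infinite_Ici by blast
      qed
      have F: "finite (?F y) \<and> card (?F y) = ?e x - ?e y \<or>
               infinite (?F y) \<and> ?e x - ?e y \<ge> length w"
        if y: "y \<in> ?Y" for y
      proof (cases y)
        case (Inl i)
        hence i: "i \<ge> 1" "i \<le> M" using y w M by auto
        show ?thesis
        proof (cases x)
          case (Inl j)
          with Fl[OF Inl i(1)] \<open>y = Inl i\<close> show ?thesis by (auto simp: card_image)
        next
          case (Inr j)
          with Finf[OF Inr i(1)] \<open>y = Inl i\<close> i N show ?thesis by auto
        qed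
      next
        case (Inr i)
        hence i: "i \<ge> 1" using y w by auto
        obtain j where j: "x = Inr j" using y Inr by (cases x) auto
        with Fr[OF j i] Inr show ?thesis by (auto simp: card_image)
      qed
      have xx: "\<not> osum_less x x" by (cases x) auto
      have Fx: "?F x = {}" by auto
      have "park_place {1..} (<) (map ?e w) (?e x)
          = Min ((\<lambda>y. 1 + ?n y + (?e x - ?e y)) ` ?Y)"
        unfolding park_place_nat[OF w'] Y image_image
        by (rule arg_cong[of _ _ Min], rule image_cong[OF refl]) (subst cnt, auto)
      also have "\<dots> = Min ((\<lambda>y. 1 + ?n y + card (?F y)) ` {y \<in> ?Y. finite (?F y)})"
      proof (rule Min_image_eqI)
        fix y assume y: "y \<in> ?Y"
        show "\<exists>b\<in>{y \<in> ?Y. finite (?F y)}. 1 + ?n b + card (?F b) \<le> 1 + ?n y + (?e x - ?e y)"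
        proof (cases "finite (?F y)")
          case True
          with y F[OF y] show ?thesis by (intro bexI[of _ y]) auto
        next
          case False
          with F[OF y] have "length w \<le> ?e x - ?e y" by auto
          moreover have "?n x \<le> length w" by simp
          ultimately have "1 + ?n x + card (?F x) \<le> 1 + ?n y + (?e x - ?e y)"
            unfolding Fx card.empty by linarith
          thus ?thesis using x xx Fx by (intro bexI[of _ x]) auto
        qed
      next
        fix y assume y: "y \<in> {y \<in> ?Y. finite (?F y)}"
        with F[of y] show "\<exists>a\<in>?Y. 1 + ?n a + (?e x - ?e a) \<le> 1 + ?n y + card (?F y)"
          by (intro bexI[of _ y]) auto
      qed (use x xx in auto)
      also have "\<dots> = park_place ?S osum_less w x"
        unfolding park_place_def by (rule arg_cong[of _ _ Min]) blast
      finally show ?thesis .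
    qed
    hence "park_on {1..} (<) (map ?e w) = park_on ?S osum_less w"
      unfolding park_on_def map_map by (intro map_cong) auto
    thus ?thesis using park_on_nat[OF w'] by simp
  qed
  thus ?thesis unfolding eventually_sequentially by blast
qed

section \<open>The algebra of colored parking functions\<close>

text \<open>Colors are the elements of a type \<open>'c\<close>; the level is the cardinality of this type.\<close>

typedef 'c cpf = "{(a, u :: 'c list). parking a \<and> length u = length a}"
  morphisms Rep_cpf Abs_cpf
  by (rule exI[of _ "([], [])"]) (simp add: parking_def)

definition cpf_letters :: "'c cpf \<Rightarrow> nat list" where "cpf_letters p = fst (Rep_cpf p)"
definition cpf_colors :: "'c cpf \<Rightarrow> 'c list" where "cpf_colors p = snd (Rep_cpf p)"
definition cpf_size :: "'c cpf \<Rightarrow> nat" where "cpf_size p = length (cpf_letters p)"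

type_synonym ('c, 'k) pqsym = "'c cpf \<Rightarrow>\<^sub>0 'k"

abbreviation G :: "'c cpf \<Rightarrow> ('c, 'k::field) pqsym" where
  "G \<equiv> bas"

definition convolution :: "nat list \<Rightarrow> nat list \<Rightarrow> nat list set" where
  "convolution a' a'' = {v @ w | v w. parking (v @ w) \<and> park v = a' \<and> park w = a''}"

definition pq_mult :: "('c, 'k::field) pqsym \<Rightarrow> ('c, 'k) pqsym \<Rightarrow> ('c, 'k) pqsym" where
  "pq_mult x y =
     (\<Sum>p\<in>keys x. \<Sum>q\<in>keys y. scale (lookup x p * lookup y q)
        (\<Sum>a\<in>convolution (cpf_letters p) (cpf_letters q).
           G (Abs_cpf (a, cpf_colors p @ cpf_colors q))))"

definition pq_one :: "('c, 'k::field) pqsym" where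
  "pq_one = G (Abs_cpf ([], []))"

definition pq_counit :: "('c, 'k::field) pqsym \<Rightarrow> 'k" where
  "pq_counit x = lookup x (Abs_cpf ([], []))"

definition pq_component :: "nat \<Rightarrow> ('c, 'k::field) pqsym set" where
  "pq_component n = module.span scale {G p | p. cpf_size p = n}"


section \<open>Realization and coproduct\<close>

text \<open>A possibly infinite linear combination of colored words is given by its coefficients.
  The realization of \<open>f\<close> over the colored alphabet \<open>S \<times> 'c\<close>, where \<open>S\<close> is totally ordered by \<open>lt\<close>:\<close>

definition G_series :: "'a set \<Rightarrow> ('a \<Rightarrow> 'a \<Rightarrow> bool) \<Rightarrow> 'c cpf \<Rightarrow> ('a \<times> 'c) list \<Rightarrow> 'k::field" where
  "G_series S lt p w =
     (if fst ` set w \<subseteq> S \<and> (park_on S lt (map fst w), map snd w) = Rep_cpf p then 1 else 0)"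

definition realize ::
    "'a set \<Rightarrow> ('a \<Rightarrow> 'a \<Rightarrow> bool) \<Rightarrow> ('c, 'k::field) pqsym \<Rightarrow> ('a \<times> 'c) list \<Rightarrow> 'k" where
  "realize S lt f w = (\<Sum>p\<in>keys f. lookup f p * G_series S lt p w)"

definition first_part :: "(('a + 'b) \<times> 'c) list \<Rightarrow> ('a \<times> 'c) list" where
  "first_part w = [(i, c). (Inl i, c) \<leftarrow> w]"

definition second_part :: "(('a + 'b) \<times> 'c) list \<Rightarrow> ('b \<times> 'c) list" where
  "second_part w = [(j, c). (Inr j, c) \<leftarrow> w]"

text \<open>The series \<open>f (A' \<oplus> A'')\<close>, where the two colored alphabets commute: the coefficient of \<open>w' w''\<close>
  collects those of all words on the sum whose restrictions to the two alphabets are \<open>w'\<close> and \<open>w''\<close>.\<close>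

definition realize_sum ::
    "('c, 'k::field) pqsym \<Rightarrow> (nat \<times> 'c) list \<times> (nat \<times> 'c) list \<Rightarrow> 'k" where
  "realize_sum f = (\<lambda>(w', w'').
     \<Sum>w | first_part w = w' \<and> second_part w = w''. realize ({1..} <+> {1..}) osum_less f w)"

text \<open>The identification of \<open>f \<otimes> g\<close> with \<open>f (A') g (A'')\<close>.\<close>

definition realize_tensor ::
    "('c cpf \<times> 'c cpf \<Rightarrow>\<^sub>0 'k::field) \<Rightarrow> (nat \<times> 'c) list \<times> (nat \<times> 'c) list \<Rightarrow> 'k" where
  "realize_tensor t = (\<lambda>(w', w'').
     \<Sum>(p, q)\<in>keys t. lookup t (p, q) *
       (realize {1..} (<) (G p) w' * realize {1..} (<) (G q) w''))"

definition pq_comult :: "('c, 'k::field) pqsym \<Rightarrow> ('c cpf \<times> 'c cpf \<Rightarrow>\<^sub>0 'k)" where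
  "pq_comult f = (THE t. realize_tensor t = realize_sum f)"

definition biword :: "'c cpf \<Rightarrow> (nat \<times> 'c) list" where
  "biword p = zip (cpf_letters p) (cpf_colors p)"

definition shifted_shuffle :: "'c cpf \<Rightarrow> 'c cpf \<Rightarrow> 'c cpf set" where
  "shifted_shuffle p q =
     {r. biword r \<in> shuffles (biword p) (map (\<lambda>(x, c). (x + cpf_size p, c)) (biword q))}"

end

theory Submission
  imports Defs "HOL-Library.Multiset"
begin

text \<open>A letter \<open>x\<close> of a word \<open>w\<close> is parked at the minimum, over the letters \<open>y \<le> x\<close> of \<open>w\<close>, of one more
  than the number of letters smaller than \<open>y\<close> plus the distance from \<open>y\<close> to \<open>x\<close>.  On an ordered sum
  the second alphabet is infinitely far from the first, so a word on the sum is parked by parking its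
  two parts separately and shifting the second one.  Hence \<open>\<Delta>(G r)\<close> is the sum of the terms obtained
  by cutting \<open>r\<close> at its breaks, the numbers \<open>k\<close> such that \<open>r\<close> has exactly \<open>k\<close> letters \<open>\<le> k\<close>.
  Coassociativity says that cutting twice does not depend on the order of the cuts, and
  multiplicativity that a factor of a parking function \<open>r\<close>, once parked, is cut at a break
  of its own exactly where \<open>r\<close> is cut.  The antipode comes from the recursion on the size that is
  available in any graded connected bialgebra.\<close>

section \<open>Linear algebra of free vector spaces\<close>

text \<open>The recursion of \<open>park\<close> does not pass to parts of a word, since removing
  letters changes the defect at every step; the minimum formula turns this into a comparison of
  minima. The main obstacle is multiplicativity: the factors of a parking function need not be
  parking functions, because parking bounds the numbers of letters from below and such bounds are
  lost with the letters. At a break \<open>k\<close> the lower bounds and the exact count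
  \<open>k\<close> together give upper bounds on the letters in each interval from \<open>y\<close>
  to \<open>k\<close>. These survive in every part of the word, and they are what makes the letters
  up to \<open>k\<close> and those above \<open>k\<close> park separately. For the converse, a word
  is rebuilt from its letters up to \<open>k\<close>, its letters above \<open>k\<close> and the
  pattern of their positions, and the two factors prescribe this pattern. The coproduct is defined
  by a description, so its formula needs a candidate with the right realization and the injectivity
  of the realization on tensors.\<close>

abbreviation linear_map :: "(('a \<Rightarrow>\<^sub>0 'k::field) \<Rightarrow> ('b \<Rightarrow>\<^sub>0 'k)) \<Rightarrow> bool" where
  "linear_map \<equiv> Vector_Spaces.linear scale scale"

interpretation FV: vector_space "scale :: 'k::field \<Rightarrow> ('b \<Rightarrow>\<^sub>0 'k) \<Rightarrow> _"
  by (rule vector_space_scale)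

text \<open>The codomain keeps an arbitrary scalar multiplication \<open>s\<close>, so that the
  criterion also covers the counit, whose values lie in the field.\<close>

lemma linear_iff_scale:
  "Vector_Spaces.linear scale s f \<longleftrightarrow> vector_space s \<and>
     (\<forall>x y. f (x + y) = f x + f y) \<and> (\<forall>c x. f (scale c x) = s c (f x))"
  by (auto simp: module_hom_iff_linear[symmetric] module_hom_iff module_iff_vector_space
      vector_space_scale)

lemma linear_mapI:
  "(\<And>x y. f (x + y) = f x + f y) \<Longrightarrow> (\<And>c x. f (scale c x) = scale c (f x)) \<Longrightarrow> linear_map f"
  by (simp add: linear_iff_scale vector_space_scale)

lemma linear_map_add: "linear_map f \<Longrightarrow> f (x + y) = f x + f y"
  and linear_map_scale: "linear_map f \<Longrightarrow> f (scale c x) = scale c (f x)"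
  by (simp_all add: linear_iff_scale)

lemma linear_map_0: "linear_map f \<Longrightarrow> f 0 = 0"
  using linear_map_add[of f 0 0] by simp

lemma linear_map_sum: "linear_map f \<Longrightarrow> f (\<Sum>a\<in>A. g a) = (\<Sum>a\<in>A. f (g a))"
  by (induction A rule: infinite_finite_induct) (simp_all add: linear_map_0 linear_map_add)

lemma linear_map_id: "linear_map (\<lambda>x. x)" "linear_map id"
  by (simp_all add: linear_iff_scale vector_space_scale)

lemma linear_map_compose: "linear_map f \<Longrightarrow> linear_map g \<Longrightarrow> linear_map (\<lambda>x. f (g x))"
  by (simp add: linear_iff_scale)

lemma lookup_bas: "lookup (bas a) b = (if a = b then 1 else 0)"
  by (simp add: lookup_single when_def)

lemma lin_ext_superset:
  assumes "finite A" "keys x \<subseteq> A"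
  shows "lin_ext \<phi> x = (\<Sum>a\<in>A. scale (lookup x a) (\<phi> a))"
  unfolding lin_ext_def using assms
  by (intro sum.mono_neutral_left) (auto simp: in_keys_iff)

lemma lin_ext_linear:
  fixes \<phi> :: "'a \<Rightarrow> ('b \<Rightarrow>\<^sub>0 'k::field)"
  shows "linear_map (lin_ext \<phi>)"
proof (rule linear_mapI)
  fix x y :: "'a \<Rightarrow>\<^sub>0 'k"
  let ?A = "keys x \<union> keys y"
  have "keys (x + y) \<subseteq> ?A" by (rule Poly_Mapping.keys_add)
  thus "lin_ext \<phi> (x + y) = lin_ext \<phi> x + lin_ext \<phi> y"
    by (simp add: lin_ext_superset[of ?A] lookup_add FV.scale_left_distrib sum.distrib)
next
  fix c :: 'k and x :: "'a \<Rightarrow>\<^sub>0 'k"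
  have "keys (scale c x) \<subseteq> keys x" by (auto simp: in_keys_iff lookup_scale)
  thus "lin_ext \<phi> (scale c x) = scale c (lin_ext \<phi> x)"
    by (simp add: lin_ext_superset[of "keys x"] lookup_scale FV.scale_sum_right)
qed

lemma lin_ext_bas [simp]: "lin_ext \<phi> (bas a) = \<phi> a"
  by (simp add: lin_ext_def)

lemma lin_ext_bas_id: "lin_ext bas x = x"
  by (rule poly_mapping_eqI)
     (simp add: lin_ext_def lookup_sum lookup_scale lookup_bas in_keys_iff if_distrib
       sum.If_cases cong: if_cong)

lemma linear_map_expand: "linear_map f \<Longrightarrow> f x = lin_ext (\<lambda>a. f (bas a)) x"
  by (subst lin_ext_bas_id[symmetric])
     (simp only: lin_ext_def linear_map_sum linear_map_scale)

text \<open>One application per argument reduces the multilinear identities below to basis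
  elements.\<close>

lemma linear_map_eqI:
  assumes "linear_map f" "linear_map g" "\<And>a. f (bas a) = g (bas a)"
  shows "f x = g x"
  using linear_map_expand[OF assms(1), of x] linear_map_expand[OF assms(2), of x] assms(3) by simp

text \<open>Bilinear maps are written as nested \<open>lin_ext\<close>; this gives linearity in the
  inner argument, \<open>lin_ext_linear\<close> in the outer one.\<close>

lemma lin_ext_linear_param:
  assumes "\<And>a. linear_map (\<lambda>y. \<phi> a y)"
  shows "linear_map (\<lambda>y. lin_ext (\<lambda>a. \<phi> a y) x)"
  by (rule linear_mapI)
     (simp_all add: lin_ext_def linear_map_add[OF assms] linear_map_scale[OF assms]
       FV.scale_right_distrib sum.distrib FV.scale_sum_right mult.commute)

lemma tensor_lin_ext:
  fixes x :: "'a \<Rightarrow>\<^sub>0 'k::field" and y :: "'b \<Rightarrow>\<^sub>0 'k"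
  shows "x \<otimes> y = lin_ext (\<lambda>a. lin_ext (\<lambda>b. bas (a, b)) y) x"
proof -
  have "scale c (Poly_Mapping.single ab d) = Poly_Mapping.single ab (c * d)"
    for ab :: "'a \<times> 'b" and c d :: 'k
    by (rule poly_mapping_eqI) (simp add: lookup_scale lookup_single when_def)
  thus ?thesis
    by (simp add: tensor_def lin_ext_def FV.scale_sum_right)
qed

lemma linear_tensor_left: "linear_map (\<lambda>x. x \<otimes> y)"
  and linear_tensor_right: "linear_map (\<lambda>y. x \<otimes> y)"
  unfolding tensor_lin_ext by (rule lin_ext_linear, rule lin_ext_linear_param, rule lin_ext_linear)

lemma tensor_bas: "bas a \<otimes> bas b = bas (a, b)"
  by (simp add: tensor_lin_ext)

lemma tensor_sum: "(\<Sum>a\<in>A. f a) \<otimes> (\<Sum>b\<in>B. g b) = (\<Sum>a\<in>A. \<Sum>b\<in>B. f a \<otimes> g b)"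
  unfolding linear_map_sum[OF linear_tensor_left] linear_map_sum[OF linear_tensor_right]
  by (rule sum.swap)

lemma tensor_mult_lin_ext:
  "tensor_mult m s t =
     lin_ext (\<lambda>(a, b). lin_ext (\<lambda>(c, d). m (bas a) (bas c) \<otimes> m (bas b) (bas d)) t) s"
  by (simp add: tensor_mult_def lin_ext_def FV.scale_sum_right case_prod_unfold)

lemma linear_tensor_mult_left: "linear_map (\<lambda>s. tensor_mult m s t)"
  and linear_tensor_mult_right: "linear_map (\<lambda>t. tensor_mult m s t)"
  unfolding tensor_mult_lin_ext case_prod_unfold
  by (rule lin_ext_linear, rule lin_ext_linear_param, rule lin_ext_linear)

text \<open>Turns the graded components, which are spans of basis elements, into conditions on
  supports.\<close>

lemma span_bas:
  fixes A :: "'a set"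
  shows "FV.span (bas ` A) = {x :: 'a \<Rightarrow>\<^sub>0 'b::field. keys x \<subseteq> A}"
proof
  show "FV.span (bas ` A) \<subseteq> {x :: 'a \<Rightarrow>\<^sub>0 'b. keys x \<subseteq> A}"
  proof (rule FV.span_minimal)
    show "FV.subspace {x :: 'a \<Rightarrow>\<^sub>0 'b. keys x \<subseteq> A}"
    proof (rule FV.subspaceI)
      fix x y :: "'a \<Rightarrow>\<^sub>0 'b"
      assume "x \<in> {x. keys x \<subseteq> A}" "y \<in> {x. keys x \<subseteq> A}"
      thus "x + y \<in> {x. keys x \<subseteq> A}" using Poly_Mapping.keys_add[of x y] by blast
    qed (auto simp: in_keys_iff lookup_scale)
  qed auto
next
  show "{x :: 'a \<Rightarrow>\<^sub>0 'b. keys x \<subseteq> A} \<subseteq> FV.span (bas ` A)"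
  proof
    fix x :: "'a \<Rightarrow>\<^sub>0 'b" assume x: "x \<in> {x. keys x \<subseteq> A}"
    have "lin_ext bas x \<in> FV.span (bas ` A)" unfolding lin_ext_def
      using x by (intro FV.span_sum FV.span_scale FV.span_base) auto
    thus "x \<in> FV.span (bas ` A)" by (simp add: lin_ext_bas_id)
  qed
qed

text \<open>The component of weight \<open>n\<close> has to be the restriction of \<open>x\<close>
  to the basis elements of weight \<open>n\<close>, since all other components vanish at these
  elements.\<close>

lemma free_direct_sum:
  fixes wt :: "'b \<Rightarrow> nat" and x :: "'b \<Rightarrow>\<^sub>0 'k::field"
  shows "\<exists>!c. finite {n. c n \<noteq> 0} \<and> (\<forall>n. keys (c n) \<subseteq> {b. wt b = n}) \<and> x = (\<Sum>n | c n \<noteq> 0. c n)"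
proof (rule ex1I)
  let ?c = "\<lambda>n. lin_ext (\<lambda>b. if wt b = n then bas b else 0) x"
  have lk: "lookup (?c n) b = (if wt b = n then lookup x b else 0)" for n b
  proof -
    have "lookup (?c n) b = (\<Sum>a\<in>keys x. if a = b then if wt b = n then lookup x b else 0 else 0)"
      unfolding lin_ext_def lookup_sum by (intro sum.cong) (auto simp: lookup_scale lookup_bas)
    thus ?thesis by (simp add: in_keys_iff)
  qed
  have sub: "{n. ?c n \<noteq> 0} \<subseteq> wt ` keys x"
  proof
    fix n assume "n \<in> {n. ?c n \<noteq> 0}"
    then obtain b where "b \<in> keys (?c n)" by fastforce
    hence "lookup (?c n) b \<noteq> 0" by (simp add: in_keys_iff)
    thus "n \<in> wt ` keys x" by (auto simp: lk in_keys_iff split: if_splits)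
  qed
  hence fin: "finite {n. ?c n \<noteq> 0}" by (rule finite_subset) simp
  have "lookup x b = lookup (\<Sum>n | ?c n \<noteq> 0. ?c n) b" for b
  proof -
    \<comment> \<open>The index \<open>wt b\<close> is inserted because its component may be zero
      and then missing from the sum; the added term is zero in that case.\<close>
    have "(\<Sum>n | ?c n \<noteq> 0. lookup (?c n) b) = (\<Sum>n\<in>insert (wt b) {n. ?c n \<noteq> 0}. lookup (?c n) b)"
      using fin by (intro sum.mono_neutral_left) auto
    also have "\<dots> = lookup x b" using fin by (simp add: lk)
    finally show ?thesis by (simp add: lookup_sum)
  qed
  hence eq: "x = (\<Sum>n | ?c n \<noteq> 0. ?c n)" by (rule poly_mapping_eqI)
  show "finite {n. ?c n \<noteq> 0} \<and> (\<forall>n. keys (?c n) \<subseteq> {b. wt b = n}) \<and> x = (\<Sum>n | ?c n \<noteq> 0. ?c n)"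
    by (intro conjI fin eq) (auto simp: in_keys_iff lk split: if_splits)
  fix d
  assume d: "finite {n. d n \<noteq> 0} \<and> (\<forall>n. keys (d n) \<subseteq> {b. wt b = n}) \<and> x = (\<Sum>n | d n \<noteq> 0. d n)"
  have z: "lookup (d n) b = 0" if "wt b \<noteq> n" for n b
  proof -
    from d have "keys (d n) \<subseteq> {b. wt b = n}" by blast
    with that show ?thesis by (auto simp: subset_eq in_keys_iff)
  qed
  have "lookup x b = lookup (d (wt b)) b" for b
  proof -
    have "lookup x b = (\<Sum>n | d n \<noteq> 0. lookup (d n) b)" using d lookup_sum by metis
    also have "\<dots> = (\<Sum>n\<in>insert (wt b) {n. d n \<noteq> 0}. lookup (d n) b)"
      using d by (intro sum.mono_neutral_left) auto
    also have "\<dots> = (\<Sum>n\<in>{wt b}. lookup (d n) b)"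
      using d z by (intro sum.mono_neutral_right) auto
    finally show ?thesis by simp
  qed
  thus "d = ?c" using z by (intro ext poly_mapping_eqI) (auto simp: lk)
qed

section \<open>Parkization as a place function\<close>

lemma sorted_nth_le_iff:
  fixes s :: "nat list"
  assumes "sorted s" "i < length s"
  shows "s ! i \<le> m \<longleftrightarrow> i < length (filter (\<lambda>z. z \<le> m) s)"
  using assms
proof (induction s arbitrary: i)
  case (Cons a s)
  show ?case
  proof (cases "a \<le> m")
    case True
    with Cons show ?thesis by (cases i) auto
  next
    case False
    with Cons.prems have "filter (\<lambda>z. z \<le> m) s = []" by (auto simp: filter_empty_conv)
    moreover have "a \<le> (a # s) ! i"
      using Cons.prems nth_mem[of i "a # s"] by (auto simp del: nth_mem)
    ultimately show ?thesis using False by simp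
  qed
qed simp

text \<open>The \<open>i\<close>-th smallest letter is at most \<open>i\<close> exactly if at least
  \<open>i\<close> letters are. The case \<open>i = length a\<close> says that all letters are at
  most the length, which recovers the upper half of the range condition.\<close>

lemma parking_iff:
  "parking a \<longleftrightarrow> set a \<subseteq> {1..} \<and> (\<forall>i\<le>length a. i \<le> length (filter (\<lambda>z. z \<le> i) a))"
  (is "_ \<longleftrightarrow> _ \<and> ?C")
proof -
  have eq: "sort a ! i \<le> i + 1 \<longleftrightarrow> i + 1 \<le> length (filter (\<lambda>z. z \<le> i + 1) a)"
    if "i < length a" for i
    using sorted_nth_le_iff[of "sort a" i "i + 1"] that by (simp add: filter_sort Suc_le_eq)
  have "(\<forall>i<length a. sort a ! i \<le> i + 1) \<longleftrightarrow> ?C"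
  proof
    assume L: "\<forall>i<length a. sort a ! i \<le> i + 1"
    show ?C
    proof (intro allI impI)
      fix i assume "i \<le> length a"
      thus "i \<le> length (filter (\<lambda>z. z \<le> i) a)" using L eq[of "i - 1"] by (cases i) auto
    qed
  next
    assume R: ?C
    show "\<forall>i<length a. sort a ! i \<le> i + 1"
    proof (intro allI impI)
      fix i assume "i < length a"
      with R[rule_format, of "i + 1"] show "sort a ! i \<le> i + 1" using eq by simp
    qed
  qed
  moreover have "set a \<subseteq> {..length a}" if ?C
  proof -
    have "length (filter (\<lambda>z. z \<le> length a) a) = length a"
      using that by (intro antisym) auto
    thus ?thesis using length_filter_less[of _ a "\<lambda>z. z \<le> length a"] by fastforce
  qed
  ultimately show ?thesis unfolding parking_def by auto
qed

lemma parking_pos: "parking a \<Longrightarrow> set a \<subseteq> {1..}"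
  by (simp add: parking_iff)

lemma parking_iff_defect: "parking a \<longleftrightarrow> set a \<subseteq> {1..} \<and> defect a = length a + 1"
  unfolding parking_iff
proof (intro conj_cong refl iffI allI impI)
  assume "\<forall>i\<le>length a. i \<le> length (filter (\<lambda>z. z \<le> i) a)"
  thus "defect a = length a + 1" using defect_prop[of a] defect_le[of a] by (metis Suc_eq_plus1 le_SucE not_le)
qed (auto intro: below_defect)

lemma park_id: "parking a \<Longrightarrow> park a = a"
  by (simp add: parking_iff_defect park.simps)

lemma parking_park: "set w \<subseteq> {1..} \<Longrightarrow> parking (park w)"
proof (induction w rule: park.induct)
  case (1 w)
  show ?case
  proof (cases "defect w = length w + 1")
    case True
    with 1(2) show ?thesis by (simp add: park_id parking_iff_defect park.simps[of w])
  next
    case False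
    have "set (map (\<lambda>z. if z > defect w then z - 1 else z) w) \<subseteq> {1..}"
      using 1(2) defect_prop[of w] by (auto simp: subset_eq)
    with 1(1)[OF False] False show ?thesis by (simp add: park.simps[of w])
  qed
qed

definition place :: "nat list \<Rightarrow> nat \<Rightarrow> nat" where
  "place w x = Min ((\<lambda>y. 1 + length (filter (\<lambda>z. z < y) w) + (x - y)) ` {y \<in> set w. y \<le> x})"

lemma park_eq_place: "set w \<subseteq> {1..} \<Longrightarrow> park w = map (place w) w"
  unfolding park_on_nat[symmetric] park_on_def by (intro map_cong) (simp_all only: park_place_nat place_def)

lemma length_park: "set w \<subseteq> {1..} \<Longrightarrow> length (park w) = length w"
  by (simp add: park_eq_place)

lemma place_le: "y \<in> set w \<Longrightarrow> y \<le> x \<Longrightarrow> place w x \<le> 1 + length (filter (\<lambda>z. z < y) w) + (x - y)"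
  unfolding place_def by (intro Min_le) auto

lemma place_attained:
  assumes "x \<in> set w"
  obtains y where "y \<in> set w" "y \<le> x" "place w x = 1 + length (filter (\<lambda>z. z < y) w) + (x - y)"
proof -
  have "place w x \<in> (\<lambda>y. 1 + length (filter (\<lambda>z. z < y) w) + (x - y)) ` {y \<in> set w. y \<le> x}"
    unfolding place_def using assms by (intro Min_in) auto
  thus ?thesis using that by blast
qed

lemma place_pos: "x \<in> set w \<Longrightarrow> 1 \<le> place w x"
  by (erule place_attained) simp

text \<open>Parking never widens a gap: a letter attaining the place of \<open>x\<close> also bounds
  the place of \<open>x'\<close>.\<close>

lemma place_step:
  assumes "x \<in> set w" "x \<le> x'"
  shows "place w x' \<le> place w x + (x' - x)"
proof -
  obtain y where "y \<in> set w" "y \<le> x" "place w x = 1 + length (filter (\<lambda>z. z < y) w) + (x - y)"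
    using assms(1) by (rule place_attained)
  with place_le[of y w x'] assms(2) show ?thesis by simp
qed

lemma length_filter_interval:
  fixes w :: "nat list"
  assumes "y \<le> y'"
  shows "length (filter (\<lambda>z. z < y') w)
    = length (filter (\<lambda>z. z < y) w) + length (filter (\<lambda>z. y \<le> z \<and> z < y') w)"
  using assms by (induction w) auto

lemma length_filter_pos: "x \<in> set w \<Longrightarrow> P x \<Longrightarrow> 0 < length (filter P w)"
  by (auto simp: filter_empty_conv)

text \<open>A letter attaining the place of \<open>x'\<close> either is at most \<open>x\<close>,
  and then bounds the place of \<open>x\<close> with a smaller distance, or exceeds
  \<open>x\<close>, and then \<open>x\<close> itself is among the letters counted below it.\<close>

lemma place_less:
  assumes "x \<in> set w" "x' \<in> set w" "x < x'"
  shows "place w x < place w x'"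
proof -
  obtain y where y: "y \<in> set w" "y \<le> x'" "place w x' = 1 + length (filter (\<lambda>z. z < y) w) + (x' - y)"
    using assms(2) by (rule place_attained)
  show ?thesis
  proof (cases "y \<le> x")
    case True
    with place_le[of y w x] y assms show ?thesis by simp
  next
    case False
    have "0 < length (filter (\<lambda>z. x \<le> z \<and> z < y) w)"
      using assms False by (intro length_filter_pos[of x]) auto
    with False place_le[of x w x] assms(1) y length_filter_interval[of x y w] show ?thesis by linarith
  qed
qed

lemma length_filter_mset_mono: "mset v \<subseteq># mset w \<Longrightarrow> length (filter P v) \<le> length (filter P w)"
  by (metis mset_filter multiset_filter_mono size_mset size_mset_mono)

text \<open>Parking a word and then a part of the result amounts to parking that part directly: whenever
  the distance between two letters shrinks, the place of the larger one is decided by a letter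
  \<open>y\<close> in between, and the letters up to \<open>y\<close> are no more numerous in the part.\<close>

lemma park_map_place:
  assumes sub: "mset v \<subseteq># mset w" and w: "set w \<subseteq> {1..}"
  shows "park (map (place w) v) = park v"
proof -
  let ?f = "place w"
  have sv: "set v \<subseteq> set w" using set_mset_mono[OF sub] by simp
  have lt: "?f x < ?f y \<longleftrightarrow> x < y" if "x \<in> set v" "y \<in> set v" for x y
    using place_less[of x w y] place_less[of y w x] subsetD[OF sv that(1)] subsetD[OF sv that(2)]
    by (cases x y rule: linorder_cases) auto
  have cnt: "length (filter (\<lambda>z. z < ?f y) (map ?f v)) = length (filter (\<lambda>z. z < y) v)"
    if "y \<in> set v" for y
    using that lt by (simp add: filter_map o_def cong: filter_cong)
  have "place (map ?f v) (?f x) = place v x" if x: "x \<in> set v" for x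
  proof (rule antisym)
    obtain y where y: "y \<in> set v" "y \<le> x" "place v x = 1 + length (filter (\<lambda>z. z < y) v) + (x - y)"
      using x by (rule place_attained)
    have "?f y \<le> ?f x" using lt[of x y] x y by (simp add: not_less[symmetric])
    hence "place (map ?f v) (?f x) \<le> 1 + length (filter (\<lambda>z. z < y) v) + (?f x - ?f y)"
      using place_le[of "?f y" "map ?f v" "?f x"] cnt[OF y(1)] y(1) by simp
    also have "\<dots> \<le> place v x" using place_step[of y w x] y sv by auto
    finally show "place (map ?f v) (?f x) \<le> place v x" .
  next
    have "?f x \<in> set (map ?f v)" using x by simp
    then obtain t' where t': "t' \<in> set (map ?f v)" "t' \<le> ?f x"
      "place (map ?f v) (?f x) = 1 + length (filter (\<lambda>z. z < t') (map ?f v)) + (?f x - t')"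
      by (rule place_attained)
    then obtain y where "y \<in> set v" "t' = ?f y" by auto
    with t' cnt have y: "y \<in> set v" "?f y \<le> ?f x"
      "place (map ?f v) (?f x) = 1 + length (filter (\<lambda>z. z < y) v) + (?f x - ?f y)"
      by simp_all
    have yx: "y \<le> x" using lt[of x y] x y by (simp add: not_less[symmetric])
    obtain t where t: "t \<in> set w" "t \<le> x" "?f x = 1 + length (filter (\<lambda>z. z < t) w) + (x - t)"
      using subsetD[OF sv x] by (rule place_attained)
    show "place v x \<le> place (map ?f v) (?f x)"
    \<comment> \<open>If the letter \<open>t\<close> deciding the place of \<open>x\<close> in
      \<open>w\<close> is at most \<open>y\<close>, it also bounds the place of \<open>y\<close>, so
      the gap from \<open>y\<close> to \<open>x\<close> has not shrunk.\<close>
    proof (cases "t \<le> y")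
      case True
      with place_le[of t w y] t yx have "?f y + (x - y) \<le> ?f x" by simp
      with place_le[of y v x] y yx show ?thesis by simp
    next
      case False
      \<comment> \<open>\<open>t\<close> is a letter of \<open>w\<close> but possibly not of
        \<open>v\<close>. The smallest letter \<open>m\<close> of \<open>v\<close> from
        \<open>t\<close> on replaces it: no letter of \<open>v\<close> lies in between, so the
        counts below \<open>m\<close> and below \<open>t\<close> agree.\<close>
      define m where "m = Min {z \<in> set v. t \<le> z}"
      have m: "m \<in> {z \<in> set v. t \<le> z}" unfolding m_def using x t by (intro Min_in) auto
      have mle: "m \<le> z" if "z \<in> set v" "t \<le> z" for z
        unfolding m_def using that by (intro Min_le) auto
      have "filter (\<lambda>z. z < m) v = filter (\<lambda>z. z < t) v"
        using m mle by (intro filter_cong) (auto simp: not_le[symmetric])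
      hence "place v x \<le> 1 + length (filter (\<lambda>z. z < t) v) + (x - m)"
        using place_le[of m v x] m mle[OF x] t by simp
      hence "place v x \<le> 1 + length (filter (\<lambda>z. z < t) v) + (x - t)"
        using m mle[OF x] t by auto
      moreover have "length (filter (\<lambda>z. y \<le> z \<and> z < t) v) \<le> length (filter (\<lambda>z. y \<le> z \<and> z < t) w)"
        by (rule length_filter_mset_mono[OF sub])
      moreover have "?f y \<le> 1 + length (filter (\<lambda>z. z < y) w)"
        using place_le[of y w y] y sv by auto
      ultimately show ?thesis
        using y(3) t(3) length_filter_interval[of y t v] length_filter_interval[of y t w] False
        by simp
    qed
  qed
  moreover have "set (map ?f v) \<subseteq> {1..}" using sv place_pos[of _ w] by auto
  moreover have "set v \<subseteq> {1..}" using sv w by blast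
  ultimately show ?thesis by (simp add: park_eq_place)
qed

text \<open>Sparseness below \<open>k\<close> prevents the letters up to \<open>k\<close> from pushing the letters above \<open>k\<close>
  further down, so the two groups of letters are parked independently of each other.\<close>

definition sparse_below :: "nat \<Rightarrow> nat list \<Rightarrow> bool" where
  "sparse_below k v \<longleftrightarrow> (\<forall>y\<le>k. length (filter (\<lambda>z. y \<le> z \<and> z \<le> k) v) \<le> Suc k - y)"

text \<open>An upper bound on counts passes to every part of a word, unlike the lower bounds that
  define parking functions.\<close>

lemma sparse_below_mset_mono: "mset v \<subseteq># mset w \<Longrightarrow> sparse_below k w \<Longrightarrow> sparse_below k v"
  unfolding sparse_below_def using length_filter_mset_mono le_trans by blast

text \<open>Of the \<open>k\<close> letters up to \<open>k\<close>, at least \<open>y - 1\<close>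
  lie below \<open>y\<close>, which leaves at most \<open>k + 1 - y\<close> of them in the interval
  from \<open>y\<close> to \<open>k\<close>.\<close>

lemma parking_sparse_below:
  assumes "parking a" "length (filter (\<lambda>z. z \<le> k) a) = k"
  shows "sparse_below k a"
  unfolding sparse_below_def
proof (intro allI impI)
  fix y assume y: "y \<le> k"
  show "length (filter (\<lambda>z. y \<le> z \<and> z \<le> k) a) \<le> Suc k - y"
  proof (cases y)
    case 0
    with assms show ?thesis by simp
  next
    case (Suc t)
    have "t \<le> length (filter (\<lambda>z. z \<le> t) a)"
      using assms y Suc length_filter_le[of "\<lambda>z. z \<le> k" a] by (auto simp: parking_iff)
    moreover have "length (filter (\<lambda>z. z \<le> t) a) + length (filter (\<lambda>z. y \<le> z \<and> z \<le> k) a)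
        = length (filter (\<lambda>z. z \<le> k) a)"
      using length_filter_interval[of y "Suc k" a] y Suc by (simp add: less_Suc_eq_le)
    ultimately show ?thesis using assms(2) Suc by simp
  qed
qed

text \<open>Only letters up to \<open>x\<close> enter the place of \<open>x\<close>. Choosing
  \<open>x\<close> itself in the minimum gives the bound, as \<open>x\<close> is one of the letters
  up to \<open>k\<close>.\<close>

lemma place_split_low:
  assumes "x \<in> set v" "x \<le> k"
  shows "place v x = place (filter (\<lambda>z. z \<le> k) v) x"
    and "place v x \<le> length (filter (\<lambda>z. z \<le> k) v)"
proof -
  have "{y \<in> set (filter (\<lambda>z. z \<le> k) v). y \<le> x} = {y \<in> set v. y \<le> x}" using assms by auto
  moreover have "filter (\<lambda>z. z < y) (filter (\<lambda>z. z \<le> k) v) = filter (\<lambda>z. z < y) v" if "y \<le> x" for y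
    unfolding filter_filter using that assms by (intro filter_cong) auto
  ultimately show "place v x = place (filter (\<lambda>z. z \<le> k) v) x"
    unfolding place_def by (intro arg_cong[of _ _ Min] image_cong) auto
  have "0 < length (filter (\<lambda>z. x \<le> z \<and> z < Suc k) v)"
    using assms by (intro length_filter_pos[of x]) auto
  thus "place v x \<le> length (filter (\<lambda>z. z \<le> k) v)"
    using place_le[of x v x] length_filter_interval[of x "Suc k" v] assms
    unfolding less_Suc_eq_le by linarith
qed

lemma place_split_high:
  assumes v: "sparse_below k v" and x: "x \<in> set v" "k < x"
  defines "u \<equiv> map (\<lambda>z. z - k) (filter (\<lambda>z. k < z) v)"
  shows "place v x = length (filter (\<lambda>z. z \<le> k) v) + place u (x - k)"
proof (rule antisym)
  let ?i = "length (filter (\<lambda>z. z \<le> k) v)"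
  have u: "length (filter (\<lambda>z. z < y) v) = ?i + length (filter (\<lambda>z. z < y - k) u)" if "k < y" for y
  proof -
    have "length (filter (\<lambda>z. z < y - k) u) = length (filter (\<lambda>z. Suc k \<le> z \<and> z < y) v)"
      using that unfolding u_def
      by (simp add: filter_map o_def, intro arg_cong[of _ _ length] filter_cong) auto
    thus ?thesis using length_filter_interval[of "Suc k" y v] that by (simp add: less_Suc_eq_le)
  qed
  have xu: "x - k \<in> set u" using x by (auto simp: u_def)
  then obtain y' where y': "y' \<in> set u" "y' \<le> x - k"
    "place u (x - k) = 1 + length (filter (\<lambda>z. z < y') u) + (x - k - y')"
    by (rule place_attained)
  then obtain y where "y \<in> set v" "k < y" "y' = y - k" by (auto simp: u_def)
  moreover from this y'(2) x(2) have "y \<le> x" by simp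
  ultimately show "place v x \<le> ?i + place u (x - k)"
    using y'(3) u[of y] place_le[of y v x] x by simp
  obtain y where y: "y \<in> set v" "y \<le> x" "place v x = 1 + length (filter (\<lambda>z. z < y) v) + (x - y)"
    using x(1) by (rule place_attained)
  show "?i + place u (x - k) \<le> place v x"
  proof (cases "k < y")
    case True
    hence "y - k \<in> set u" using y by (auto simp: u_def)
    moreover have "x - k - (y - k) = x - y" "y - k \<le> x - k" using True y by auto
    ultimately show ?thesis using place_le[of "y - k" u "x - k"] u[OF True] y by linarith
  next
    case False
    \<comment> \<open>The smallest letter \<open>m\<close> above \<open>k\<close> does at least as
      well as \<open>y\<close>: by sparseness \<open>y\<close> yields at least
      \<open>?i + (x - k)\<close>, while \<open>m\<close>, being at least \<open>k + 1\<close>,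
      yields at most that.\<close>
    define m where "m = Min {z \<in> set v. k < z}"
    have m: "m \<in> {z \<in> set v. k < z}" unfolding m_def using x by (intro Min_in) auto
    have mle: "m \<le> z" if "z \<in> set v" "k < z" for z
      unfolding m_def using that by (intro Min_le) auto
    have "filter (\<lambda>z. z < m) v = filter (\<lambda>z. z \<le> k) v"
      using m mle by (intro filter_cong) (auto simp: not_le[symmetric])
    hence "length (filter (\<lambda>z. z < m - k) u) = 0" using u[of m] m by simp
    moreover have "m - k \<in> set u" using m by (auto simp: u_def)
    ultimately have "place u (x - k) \<le> 1 + (x - m)"
      using place_le[of "m - k" u "x - k"] m mle[OF x] x by simp
    moreover have "length (filter (\<lambda>z. y \<le> z \<and> z \<le> k) v) \<le> Suc k - y"
      using v False by (simp add: sparse_below_def)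
    moreover have "k < m" "m \<le> x" using m mle[OF x] by auto
    ultimately show ?thesis
      using y False length_filter_interval[of y "Suc k" v]
      unfolding less_Suc_eq_le by linarith
  qed
qed

section \<open>Cutting colored parking functions\<close>

abbreviation low :: "nat \<Rightarrow> (nat \<times> 'c) list \<Rightarrow> (nat \<times> 'c) list" where
  "low k w \<equiv> filter (\<lambda>z. fst z \<le> k) w"

abbreviation high :: "nat \<Rightarrow> (nat \<times> 'c) list \<Rightarrow> (nat \<times> 'c) list" where
  "high k w \<equiv> map (apfst (\<lambda>x. x - k)) (filter (\<lambda>z. k < fst z) w)"

abbreviation positive :: "(nat \<times> 'c) list \<Rightarrow> bool" where
  "positive w \<equiv> fst ` set w \<subseteq> {1..}"

definition cpark :: "(nat \<times> 'c) list \<Rightarrow> 'c cpf" where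
  "cpark w = Abs_cpf (park (map fst w), map snd w)"

definition cpf_empty :: "'c cpf" where
  "cpf_empty = Abs_cpf ([], [])"

lemma Rep_cpf_split:
  "Rep_cpf p = (cpf_letters p, cpf_colors p)" "parking (cpf_letters p)"
  "length (cpf_colors p) = length (cpf_letters p)"
  using Rep_cpf[of p] by (auto simp: cpf_letters_def cpf_colors_def)

lemma map_fst_biword: "map fst (biword p) = cpf_letters p"
  and map_snd_biword: "map snd (biword p) = cpf_colors p"
  by (simp_all add: biword_def Rep_cpf_split)

lemma parking_biword: "parking (map fst (biword p))"
  by (simp add: map_fst_biword Rep_cpf_split)

lemma positive_biword: "positive (biword p)"
  using parking_pos[OF parking_biword[of p]] by simp

lemma length_biword: "length (biword p) = cpf_size p"
  by (simp add: biword_def Rep_cpf_split cpf_size_def)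

lemma biword_inject: "biword p = biword q \<longleftrightarrow> p = q"
  by (metis Rep_cpf_inject Rep_cpf_split(1) map_fst_biword map_snd_biword)

lemma Rep_cpf_cpark:
  assumes "positive w"
  shows "Rep_cpf (cpark w) = (park (map fst w), map snd w)"
  unfolding cpark_def using assms
  by (subst Abs_cpf_inverse) (auto simp: parking_park length_park)

text \<open>Written as a map on biletters, parking can be compared with filters, \<open>take\<close>
  and \<open>drop\<close>, the colors following their letters.\<close>

lemma biword_cpark:
  assumes "positive w"
  shows "biword (cpark w) = map (apfst (place (map fst w))) w"
proof -
  have "biword (cpark w) = zip (map (place (map fst w)) (map fst w)) (map snd w)"
    using assms Rep_cpf_cpark[OF assms]
    by (simp add: biword_def cpf_letters_def cpf_colors_def park_eq_place)
  also have "\<dots> = map (apfst (place (map fst w))) w"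
    by (induction w) (auto simp: zip_map1 zip_map2 o_def apfst_def map_prod_def split_beta zip_same_conv_map)
  finally show ?thesis .
qed

lemma cpark_eq_iff:
  "positive w \<Longrightarrow> cpark w = p \<longleftrightarrow> (park (map fst w), map snd w) = Rep_cpf p"
  by (metis Rep_cpf_inject Rep_cpf_cpark)

lemma size_cpark: "positive w \<Longrightarrow> cpf_size (cpark w) = length w"
  using length_biword[of "cpark w"] by (simp add: biword_cpark)

lemma cpark_biword: "cpark (biword p) = p"
  unfolding cpark_def
  by (simp add: map_fst_biword map_snd_biword park_id Rep_cpf_split(2) Rep_cpf_split(1)[symmetric]
      Rep_cpf_inverse)

lemma biword_cpark_parking:
  assumes "parking (map fst w)"
  shows "biword (cpark w) = w"
proof -
  have "positive w" using parking_pos[OF assms] by simp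
  hence "Rep_cpf (cpark w) = (map fst w, map snd w)" using assms by (simp add: Rep_cpf_cpark park_id)
  thus ?thesis by (simp add: biword_def cpf_letters_def cpf_colors_def zip_map_fst_snd)
qed

lemma cpf_empty_cpark: "cpf_empty = cpark []"
  by (simp add: cpf_empty_def cpark_def parking_def park_id)

lemma cpf_empty: "biword cpf_empty = []" "cpf_size cpf_empty = 0"
  by (simp_all add: cpf_empty_cpark biword_cpark size_cpark)

lemma cpf_size_0_iff: "cpf_size p = 0 \<longleftrightarrow> p = cpf_empty"
  by (metis biword_inject cpf_empty length_0_conv length_biword)

lemma finite_cpf_size: "finite {p :: 'c::finite cpf. cpf_size p = n}"
proof (rule finite_imageD)
  let ?W = "{w :: (nat \<times> 'c) list. set w \<subseteq> {1..n} \<times> UNIV \<and> length w = n}"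
  have "biword ` {p :: 'c cpf. cpf_size p = n} \<subseteq> ?W"
  proof
    fix w :: "(nat \<times> 'c) list" assume "w \<in> biword ` {p. cpf_size p = n}"
    then obtain p where p: "w = biword p" "cpf_size p = n" by auto
    hence "set (map fst w) \<subseteq> {1..n}"
      using parking_biword[of p] by (simp only: parking_def length_map length_biword)
    thus "w \<in> ?W" using p by (force simp: length_biword)
  qed
  thus "finite (biword ` {p :: 'c cpf. cpf_size p = n})"
    by (rule finite_subset) (auto intro: finite_lists_length_eq)
qed (simp add: inj_on_def biword_inject)

text \<open>The counting conditions up to \<open>k\<close> see only the letters up to
  \<open>k\<close>. The condition at \<open>i + k\<close> becomes the one at \<open>i\<close> for
  the lowered letters above \<open>k\<close>, because exactly \<open>k\<close> letters are at most
  \<open>k\<close>.\<close>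

lemma parking_split:
  assumes k: "length (filter (\<lambda>z. z \<le> k) a) = k"
  shows "parking a \<longleftrightarrow> parking (filter (\<lambda>z. z \<le> k) a) \<and> parking (map (\<lambda>z. z - k) (filter (\<lambda>z. k < z) a))"
    (is "_ \<longleftrightarrow> parking ?l \<and> parking ?h")
proof -
  have len: "length a = k + length ?h"
    using k sum_length_filter_compl[of "\<lambda>z. z \<le> k" a] by (simp add: not_le)
  have lo: "filter (\<lambda>z. z \<le> i) ?l = filter (\<lambda>z. z \<le> i) a" if "i \<le> k" for i
    unfolding filter_filter using that by (intro filter_cong) auto
  have hi: "length (filter (\<lambda>z. z \<le> i + k) a) = k + length (filter (\<lambda>z. z \<le> i) ?h)" for i
  proof -
    have "length (filter (\<lambda>z. z \<le> i) ?h) = length (filter (\<lambda>z. Suc k \<le> z \<and> z < Suc (i + k)) a)"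
      by (simp add: filter_map o_def, intro arg_cong[of _ _ length] filter_cong) auto
    thus ?thesis using length_filter_interval[of "Suc k" "Suc (i + k)" a] k
      by (simp add: less_Suc_eq_le)
  qed
  have "(\<forall>i\<le>length a. i \<le> length (filter (\<lambda>z. z \<le> i) a)) \<longleftrightarrow>
    (\<forall>i\<le>k. i \<le> length (filter (\<lambda>z. z \<le> i) a)) \<and>
    (\<forall>i\<le>length ?h. i + k \<le> length (filter (\<lambda>z. z \<le> i + k) a))" (is "?A \<longleftrightarrow> ?B \<and> ?C")
  proof
    assume B: "?B \<and> ?C"
    show ?A
    proof (intro allI impI)
      fix i assume "i \<le> length a"
      with B len show "i \<le> length (filter (\<lambda>z. z \<le> i) a)"
        by (cases "i \<le> k") (auto dest!: spec[of _ "i - k"])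
    qed
  qed (simp add: len del: length_map)
  moreover have "set a \<subseteq> {1..} \<longleftrightarrow> set ?l \<subseteq> {1..} \<and> set ?h \<subseteq> {1..}" by (auto simp: Suc_le_eq)
  ultimately show ?thesis
    unfolding parking_iff using k lo by (auto simp: hi)
qed

section \<open>Breaks and the two parts at a break\<close>

definition breaks :: "'c cpf \<Rightarrow> nat set" where
  "breaks r = {k. length (low k (biword r)) = k}"

text \<open>\<open>cpark\<close> makes the part a colored parking function for every
  \<open>k\<close>; at a break it leaves the word as it is, by \<open>biword_lcut\<close>.\<close>

definition lcut :: "nat \<Rightarrow> 'c cpf \<Rightarrow> 'c cpf" where
  "lcut k r = cpark (low k (biword r))"

definition rcut :: "nat \<Rightarrow> 'c cpf \<Rightarrow> 'c cpf" where
  "rcut k r = cpark (high k (biword r))"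

lemma map_fst_low: "map fst (low k w) = filter (\<lambda>z. z \<le> k) (map fst w)"
  and map_fst_high: "map fst (high k w) = map (\<lambda>z. z - k) (filter (\<lambda>z. k < z) (map fst w))"
  by (simp_all add: filter_map o_def)

lemma length_low: "length (low k w) = length (filter (\<lambda>z. z \<le> k) (map fst w))"
  by (simp add: filter_map o_def)

lemma positive_low: "positive w \<Longrightarrow> positive (low k w)"
  and positive_high: "positive (high k w)"
  by auto

lemma parking_colored_split:
  assumes "length (low k w) = k"
  shows "parking (map fst w) \<longleftrightarrow> parking (map fst (low k w)) \<and> parking (map fst (high k w))"
  using assms unfolding map_fst_low map_fst_high length_low by (rule parking_split)

lemma biword_lcut: "k \<in> breaks r \<Longrightarrow> biword (lcut k r) = low k (biword r)"
  and biword_rcut: "k \<in> breaks r \<Longrightarrow> biword (rcut k r) = high k (biword r)"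
  unfolding lcut_def rcut_def breaks_def
  using parking_colored_split[of k "biword r"] by (auto simp: parking_biword biword_cpark_parking)

lemma length_low_breaks: "k \<in> breaks r \<Longrightarrow> length (low k (biword r)) = k"
  by (simp add: breaks_def)

lemma size_lcut: "k \<in> breaks r \<Longrightarrow> cpf_size (lcut k r) = k"
  by (simp only: length_biword[symmetric] biword_lcut length_low_breaks)

lemma breaks_le: "k \<in> breaks r \<Longrightarrow> k \<le> cpf_size r"
  using length_filter_le[of "\<lambda>z. fst z \<le> k" "biword r"]
  by (simp add: length_low_breaks length_biword)

lemma finite_breaks: "finite (breaks r)"
  by (rule finite_subset[of _ "{..cpf_size r}"]) (auto dest: breaks_le)

lemma size_rcut: "k \<in> breaks r \<Longrightarrow> cpf_size (rcut k r) = cpf_size r - k"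
  using sum_length_filter_compl[of "\<lambda>z. fst z \<le> k" "biword r"] length_low_breaks[of k r]
  unfolding length_biword[symmetric] not_le by (simp add: biword_rcut)

lemma low_size: "cpf_size r \<le> k \<Longrightarrow> low k (biword r) = biword r"
  using parking_biword[of r] unfolding parking_def length_map length_biword
  by (force simp: filter_id_conv)

lemma low_0: "low 0 (biword r) = []"
  using positive_biword[of r] by (force simp: filter_empty_conv)

lemma high_0: "high 0 (biword r) = biword r"
proof -
  have "filter (\<lambda>z. 0 < fst z) (biword r) = biword r"
    using positive_biword[of r] by (force simp: filter_id_conv)
  thus ?thesis by (auto intro!: map_idI)
qed

lemma zero_breaks: "0 \<in> breaks r"
  and size_breaks: "cpf_size r \<in> breaks r"
  unfolding breaks_def mem_Collect_eq low_0 low_size[OF order_refl] by (simp_all add: length_biword)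

lemma lcut_size: "lcut (cpf_size r) r = r"
  and rcut_0: "rcut 0 r = r"
  by (simp_all only: lcut_def rcut_def low_size[OF order_refl] high_0 cpark_biword)

lemma lcut_0: "lcut 0 r = cpf_empty"
  and rcut_size: "rcut (cpf_size r) r = cpf_empty"
  by (simp_all add: cpf_size_0_iff[symmetric] size_lcut size_rcut zero_breaks size_breaks)

lemma breaks_empty: "breaks cpf_empty = {0}"
  by (auto simp: breaks_def cpf_empty)

lemma low_low: "j \<le> k \<Longrightarrow> low j (low k w) = low j w"
  by (auto intro: filter_cong)

lemma low_high: "low i (high k w) = high k (low (i + k) w)"
  by (simp add: filter_map o_def, intro arg_cong[of _ _ "map _"] filter_cong) auto

lemma high_high: "high i (high k w) = high (i + k) w"
proof -
  have "filter (\<lambda>z. k < fst z \<and> i + k < fst z) w = filter (\<lambda>z. i + k < fst z) w"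
    by (intro filter_cong) auto
  thus ?thesis by (simp add: filter_map o_def apfst_compose less_diff_conv add.commute)
qed

lemma length_low_add: "length (low (i + k) w) = length (low k w) + length (low i (high k w))"
  by (induction w) auto

lemma breaks_lcut: "k \<in> breaks r \<Longrightarrow> breaks (lcut k r) = {j \<in> breaks r. j \<le> k}"
proof (intro set_eqI iffI)
  fix j assume k: "k \<in> breaks r" and j: "j \<in> breaks (lcut k r)"
  have "j \<le> k" using breaks_le[OF j] k by (simp add: size_lcut)
  with j k show "j \<in> {j \<in> breaks r. j \<le> k}" by (simp add: breaks_def biword_lcut low_low del: filter_filter)
qed (auto simp: breaks_def biword_lcut low_low simp del: filter_filter)

lemma breaks_rcut: "k \<in> breaks r \<Longrightarrow> i \<in> breaks (rcut k r) \<longleftrightarrow> i + k \<in> breaks r"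
  using length_low_add[of i k "biword r"] length_low_breaks[of k r] biword_rcut[of k r]
  by (simp add: breaks_def)

lemma lcut_lcut: "j \<le> k \<Longrightarrow> k \<in> breaks r \<Longrightarrow> lcut j (lcut k r) = lcut j r"
  by (simp only: lcut_def[of j] biword_lcut low_low)

lemma rcut_rcut: "k \<in> breaks r \<Longrightarrow> rcut i (rcut k r) = rcut (i + k) r"
  by (simp only: rcut_def[of i] rcut_def[of "i + k"] biword_rcut high_high)

text \<open>Both sides are the middle part between the cuts at \<open>k\<close> and
  \<open>i + k\<close>.\<close>

lemma lcut_rcut: "k \<in> breaks r \<Longrightarrow> i + k \<in> breaks r \<Longrightarrow> lcut i (rcut k r) = rcut k (lcut (i + k) r)"
  by (simp only: lcut_def[of i "rcut k r"] rcut_def[of k "lcut (i + k) r"]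
      biword_rcut biword_lcut low_high)

text \<open>A predicate separating the two words recovers both from any shuffle. It is used with the
  bound \<open>k\<close> for shifted shuffles and with \<open>isl\<close> for the ordered
  sum.\<close>

lemma filter_shuffles_partition:
  assumes "\<forall>x\<in>set xs. P x" "\<forall>y\<in>set ys. \<not> P y"
  shows "zs \<in> shuffles xs ys \<longleftrightarrow> filter P zs = xs \<and> filter (\<lambda>x. \<not> P x) zs = ys"
proof
  assume zs: "zs \<in> shuffles xs ys"
  have "filter P zs \<in> filter P ` shuffles xs ys"
    "filter (\<lambda>x. \<not> P x) zs \<in> filter (\<lambda>x. \<not> P x) ` shuffles xs ys" using zs by auto
  moreover have "filter P xs = xs" "filter P ys = []"
    "filter (\<lambda>x. \<not> P x) xs = []" "filter (\<lambda>x. \<not> P x) ys = ys"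
    using assms by (simp_all add: filter_id_conv filter_empty_conv)
  ultimately show "filter P zs = xs \<and> filter (\<lambda>x. \<not> P x) zs = ys" by (simp add: filter_shuffles)
qed (use partition_in_shuffles in blast)

text \<open>The letters of \<open>p\<close> are at most its size and the shifted letters of
  \<open>q\<close> exceed it, so the shuffled words are the low and high words of \<open>r\<close>
  at that size.\<close>

lemma shifted_shuffle_iff:
  "r \<in> shifted_shuffle p q \<longleftrightarrow>
     cpf_size p \<in> breaks r \<and> lcut (cpf_size p) r = p \<and> rcut (cpf_size p) r = q"
proof -
  let ?k = "cpf_size p"
  let ?s = "\<lambda>(x, c). (x + ?k, c)"
  have lo: "\<forall>z\<in>set (biword p). fst z \<le> ?k"
    using parking_biword[of p] unfolding parking_def length_map length_biword by force
  have hi: "\<forall>z\<in>set (map ?s (biword q)). \<not> fst z \<le> ?k"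
    using positive_biword[of q] by force
  have sh: "filter (\<lambda>z. \<not> fst z \<le> ?k) w = map ?s (biword q) \<longleftrightarrow> high ?k w = biword q" for w
  proof
    assume "filter (\<lambda>z. \<not> fst z \<le> ?k) w = map ?s (biword q)"
    thus "high ?k w = biword q" by (simp add: not_le o_def split_beta)
  next
    assume "high ?k w = biword q"
    hence "map ?s (biword q) = map (\<lambda>z. z) (filter (\<lambda>z. ?k < fst z) w)"
      unfolding \<open>high ?k w = biword q\<close>[symmetric] map_map by (intro map_cong) auto
    thus "filter (\<lambda>z. \<not> fst z \<le> ?k) w = map ?s (biword q)" by (simp add: not_le)
  qed
  have "r \<in> shifted_shuffle p q \<longleftrightarrow> low ?k (biword r) = biword p \<and> high ?k (biword r) = biword q"
    unfolding shifted_shuffle_def using filter_shuffles_partition[OF lo hi] sh by blast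
  also have "\<dots> \<longleftrightarrow> ?k \<in> breaks r \<and> lcut ?k r = p \<and> rcut ?k r = q"
  proof
    assume "low ?k (biword r) = biword p \<and> high ?k (biword r) = biword q"
    thus "?k \<in> breaks r \<and> lcut ?k r = p \<and> rcut ?k r = q"
      by (simp add: breaks_def lcut_def rcut_def cpark_biword length_biword)
  next
    assume *: "?k \<in> breaks r \<and> lcut ?k r = p \<and> rcut ?k r = q"
    with biword_lcut[of ?k r] biword_rcut[of ?k r]
    show "low ?k (biword r) = biword p \<and> high ?k (biword r) = biword q" by simp
  qed
  finally show ?thesis .
qed

lemma inj_on_cuts: "inj_on (\<lambda>k. (lcut k r, rcut k r)) (breaks r)"
  by (rule inj_onI) (metis Pair_inject size_lcut)

lemma shifted_shuffle_cuts:
  "{(p, q). r \<in> shifted_shuffle p q} = (\<lambda>k. (lcut k r, rcut k r)) ` breaks r"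
  by (auto simp: shifted_shuffle_iff size_lcut image_iff) metis

section \<open>Realization over an ordered sum of two alphabets\<close>

definition cut_sum :: "'c cpf \<Rightarrow> ('c cpf \<times> 'c cpf \<Rightarrow>\<^sub>0 'k::field)" where
  "cut_sum r = (\<Sum>k\<in>breaks r. bas (lcut k r, rcut k r))"

text \<open>No coefficient exceeds 1, because a break is recovered as the size of the left
  part.\<close>

lemma lookup_cut_sum:
  "lookup (cut_sum r) (p, q) = (if r \<in> shifted_shuffle p q then 1 else 0 :: 'k::field)"
proof -
  have "cut_sum r = (\<Sum>x\<in>{(p, q). r \<in> shifted_shuffle p q}. bas x :: _ \<Rightarrow>\<^sub>0 'k)"
    unfolding cut_sum_def shifted_shuffle_cuts by (simp add: sum.reindex inj_on_cuts)
  moreover have "finite {(p, q). r \<in> shifted_shuffle p q}"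
    unfolding shifted_shuffle_cuts by (simp add: finite_breaks)
  ultimately show ?thesis by (simp add: lookup_sum lookup_bas)
qed

text \<open>The positions of the letters satisfying \<open>P\<close> and the two subwords determine
  the word. The injectivity arguments for realizations and for products both rest on this.\<close>

lemma list_eq_by_partition:
  "map P x = map P y \<Longrightarrow> filter P x = filter P y \<Longrightarrow> filter (\<lambda>z. \<not> P z) x = filter (\<lambda>z. \<not> P z) y
    \<Longrightarrow> x = y"
proof (induction x arbitrary: y)
  case (Cons a x)
  then obtain b y' where "y = b # y'" by (cases y) auto
  with Cons show ?case by (auto split: if_splits)
qed simp

lemma image_map_shuffles: "map f ` shuffles xs ys = shuffles (map f xs) (map f ys)"
proof (induction xs ys rule: shuffles.induct)
  case (3 x xs y ys)
  have "map f ` shuffles (x # xs) (y # ys) =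
      (#) (f x) ` map f ` shuffles xs (y # ys) \<union> (#) (f y) ` map f ` shuffles (x # xs) ys"
    by (simp add: image_Un image_image)
  thus ?case unfolding 3 by simp
qed auto

section \<open>Words on the ordered sum and their two restrictions\<close>

lemma map_first_part: "map (apfst Inl) (first_part w) = filter (\<lambda>z. isl (fst z)) w"
  by (induction w) (auto simp: first_part_def split: sum.splits)

lemma map_second_part: "map (apfst Inr) (second_part w) = filter (\<lambda>z. \<not> isl (fst z)) w"
  by (induction w) (auto simp: second_part_def split: sum.splits)

text \<open>The index set of the sum in \<open>realize_sum\<close> becomes a shuffle set, which in
  particular is finite.\<close>

lemma parts_iff_shuffles:
  "first_part w = w' \<and> second_part w = w'' \<longleftrightarrow> w \<in> shuffles (map (apfst Inl) w') (map (apfst Inr) w'')"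
proof -
  have "inj (map (apfst (Inl :: 'a \<Rightarrow> 'a + 'c)) :: ('a \<times> 'b) list \<Rightarrow> _)"
    "inj (map (apfst (Inr :: 'c \<Rightarrow> 'a + 'c)) :: ('c \<times> 'b) list \<Rightarrow> _)"
    by (auto intro!: inj_mapI injI simp: apfst_def map_prod_def split: prod.splits)
  hence "first_part w = w' \<and> second_part w = w'' \<longleftrightarrow>
      filter (\<lambda>z. isl (fst z)) w = map (apfst Inl) w' \<and>
      filter (\<lambda>z. \<not> isl (fst z)) w = map (apfst Inr) w''"
    unfolding map_first_part[symmetric] map_second_part[symmetric] by (simp add: inj_eq)
  also have "\<dots> \<longleftrightarrow> w \<in> shuffles (map (apfst Inl) w') (map (apfst Inr) w'')"
    by (rule filter_shuffles_partition[symmetric]) auto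
  finally show ?thesis .
qed

definition lefts :: "('a + 'b) list \<Rightarrow> 'a list" where "lefts W = [i. Inl i \<leftarrow> W]"
definition rights :: "('a + 'b) list \<Rightarrow> 'b list" where "rights W = [j. Inr j \<leftarrow> W]"

lemma lefts_rights_simps [simp]:
  "lefts [] = []" "lefts (Inl i # W) = i # lefts W" "lefts (Inr j # W) = lefts W"
  "rights [] = []" "rights (Inl i # W) = rights W" "rights (Inr j # W) = j # rights W"
  by (simp_all add: lefts_def rights_def)

lemma lefts_rights_first_second:
  "lefts (map fst w) = map fst (first_part w)" "rights (map fst w) = map fst (second_part w)"
  by (induction w) (auto simp: first_part_def second_part_def lefts_def rights_def split: sum.splits)

lemma set_lefts_rights: "Inl i \<in> set W \<longleftrightarrow> i \<in> set (lefts W)" "Inr j \<in> set W \<longleftrightarrow> j \<in> set (rights W)"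
  by (auto simp: lefts_def rights_def split: sum.splits)

lemma length_filter_osum_less:
  "length (filter (\<lambda>z. osum_less z (Inl i)) W) = length (filter (\<lambda>z. z < i) (lefts W))"
  "length (filter (\<lambda>z. osum_less z (Inr j)) W) = length (lefts W) + length (filter (\<lambda>z. z < j) (rights W))"
proof (induction W)
  case (Cons a W)
  { case 1 show ?case using Cons by (cases a) auto }
  { case 2 show ?case using Cons by (cases a) auto }
qed auto

text \<open>For a letter of the first copy only letters of the same copy enter the minimum. A letter
  of the second copy is at infinite distance from the first, so again only its own copy enters, but
  every letter of the first copy is counted below it.\<close>

lemma park_place_osum:
  assumes W: "set W \<subseteq> {1..} <+> {1..}"
  shows "Inl i \<in> set W \<Longrightarrow> park_place ({1..} <+> {1..}) osum_less W (Inl i) = place (lefts W) i"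
    and "Inr j \<in> set W \<Longrightarrow>
      park_place ({1..} <+> {1..}) osum_less W (Inr j) = length (lefts W) + place (rights W) j"
proof -
  let ?S = "{1..} <+> {1..} :: (nat + nat) set"
  let ?F = "\<lambda>x y. {z \<in> ?S. \<not> osum_less z y \<and> osum_less z x}"
  let ?n = "\<lambda>y. length (filter (\<lambda>z. osum_less z y) W)"
  have pos: "1 \<le> i" if "Inl i \<in> set W" for i using that W by auto
  have pos': "1 \<le> j" if "Inr j \<in> set W" for j using that W by auto
  have Fl: "?F (Inl i) (Inl b) = Inl ` {b..<i}" if "1 \<le> b" for i b
    using that by (auto simp: image_iff elim!: PlusE)
  have Fr: "?F (Inr j) (Inr b) = Inr ` {b..<j}" if "1 \<le> b" for j b
    using that by (auto simp: image_iff elim!: PlusE)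
  have Finf: "infinite (?F (Inr j) (Inl b))" if "1 \<le> b" for j b
  proof
    assume "finite (?F (Inr j) (Inl b))"
    moreover have "Inl ` {b..} \<subseteq> ?F (Inr j) (Inl b)" using that by auto
    ultimately have "finite (Inl ` {b..} :: (nat + nat) set)" by (rule rev_finite_subset)
    thus False by (simp add: finite_image_iff infinite_Ici)
  qed
  { assume i: "Inl i \<in> set W"
    have "{1 + ?n y + card (?F (Inl i) y) | y.
            y \<in> set W \<and> \<not> osum_less (Inl i) y \<and> finite (?F (Inl i) y)} =
          (\<lambda>b. 1 + length (filter (\<lambda>z. z < b) (lefts W)) + (i - b)) ` {b \<in> set (lefts W). b \<le> i}"
      (is "?A = ?f ` ?B")
    proof (intro set_eqI iffI)
      fix v assume "v \<in> ?A"
      then obtain y where y: "v = 1 + ?n y + card (?F (Inl i) y)" "y \<in> set W" "\<not> osum_less (Inl i) y"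
        by blast
      then obtain b where b: "y = Inl b" "b \<le> i" by (cases y) auto
      with y Fl[OF pos[of b]] have "v = ?f b"
        by (simp add: length_filter_osum_less card_image)
      moreover have "b \<in> ?B" using b y by (simp add: set_lefts_rights)
      ultimately show "v \<in> ?f ` ?B" by blast
    next
      fix v assume "v \<in> ?f ` ?B"
      then obtain b where b: "v = ?f b" "b \<in> set (lefts W)" "b \<le> i" by blast
      hence bW: "Inl b \<in> set W" by (simp add: set_lefts_rights)
      have "v = 1 + ?n (Inl b) + card (?F (Inl i) (Inl b))" "finite (?F (Inl i) (Inl b))"
        using b unfolding Fl[OF pos[OF bW]] by (simp_all add: length_filter_osum_less card_image)
      moreover have "\<not> osum_less (Inl i) (Inl b)" using b by simp
      ultimately show "v \<in> ?A" using bW by blast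
    qed
    thus "park_place ?S osum_less W (Inl i) = place (lefts W) i"
      unfolding park_place_def place_def by (rule arg_cong) }
  { assume j: "Inr j \<in> set W"
    let ?f = "\<lambda>b. 1 + length (filter (\<lambda>z. z < b) (rights W)) + (j - b)"
    let ?B = "{b \<in> set (rights W). b \<le> j}"
    have "{1 + ?n y + card (?F (Inr j) y) | y.
            y \<in> set W \<and> \<not> osum_less (Inr j) y \<and> finite (?F (Inr j) y)} =
          (+) (length (lefts W)) ` ?f ` ?B"
      (is "?A = _")
    proof (intro set_eqI iffI)
      fix v assume "v \<in> ?A"
      then obtain y where y: "v = 1 + ?n y + card (?F (Inr j) y)" "y \<in> set W" "\<not> osum_less (Inr j) y"
        "finite (?F (Inr j) y)" by blast
      then obtain b where b: "y = Inr b" "b \<le> j"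
        using Finf[OF pos, of _ j] by (cases y) auto
      with y Fr[OF pos'[of b]] have "v = length (lefts W) + ?f b"
        by (simp add: length_filter_osum_less card_image)
      moreover have "b \<in> ?B" using b y by (simp add: set_lefts_rights)
      ultimately show "v \<in> (+) (length (lefts W)) ` ?f ` ?B" by blast
    next
      fix v assume "v \<in> (+) (length (lefts W)) ` ?f ` ?B"
      then obtain b where b: "v = length (lefts W) + ?f b" "b \<in> set (rights W)" "b \<le> j" by blast
      hence bW: "Inr b \<in> set W" by (simp add: set_lefts_rights)
      have "v = 1 + ?n (Inr b) + card (?F (Inr j) (Inr b))" "finite (?F (Inr j) (Inr b))"
        using b unfolding Fr[OF pos'[OF bW]] by (simp_all add: length_filter_osum_less card_image)
      moreover have "\<not> osum_less (Inr j) (Inr b)" using b by simp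
      ultimately show "v \<in> ?A" using bW by blast
    qed
    hence "park_place ?S osum_less W (Inr j) = Min ((+) (length (lefts W)) ` ?f ` ?B)"
      unfolding park_place_def by (rule arg_cong)
    also have "\<dots> = length (lefts W) + Min (?f ` ?B)"
      using j by (intro hom_Min_commute[symmetric]) (auto simp: set_lefts_rights)
    finally show "park_place ?S osum_less W (Inr j) = length (lefts W) + place (rights W) j"
      unfolding place_def . }
qed

section \<open>Coefficients of realizations\<close>

lemma realize_bas:
  "realize {1..} (<) (bas p) w = (if positive w \<and> cpark w = p then 1 else 0 :: 'k::field)"
proof -
  have "park_on {1..} (<) (map fst w) = park (map fst w)" if "positive w"
    using that by (intro park_on_nat) auto
  thus ?thesis by (auto simp: realize_def G_series_def cpark_eq_iff simp del: One_nat_def)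
qed

text \<open>A pair of words occurs only in the term of its own parkizations, so a single summand
  survives and the realization lists the coefficients of \<open>t\<close>.\<close>

lemma realize_tensor_eq:
  "realize_tensor t (w', w'') =
    (if positive w' \<and> positive w'' then lookup t (cpark w', cpark w'') else 0 :: 'k::field)"
proof -
  have "(case z of (p, q) \<Rightarrow> lookup t (p, q) *
      (realize {1..} (<) (G p) w' * realize {1..} (<) (G q) w'')) =
    (if (cpark w', cpark w'') = z then (if positive w' \<and> positive w'' then lookup t z else 0) else 0)"
    for z
    by (cases z) (simp add: realize_bas del: One_nat_def)
  thus ?thesis by (simp add: realize_tensor_def in_keys_iff del: One_nat_def)
qed

text \<open>Parking maps the shuffle set bijectively onto the shuffles of the parked first part with
  the shifted parked second part, and the series of \<open>r\<close> selects the words sent to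
  \<open>biword r\<close>.\<close>

lemma sum_G_series_shuffles:
  assumes "positive w'" "positive w''"
  shows "(\<Sum>w\<in>shuffles (map (apfst Inl) w') (map (apfst Inr) w'').
      G_series ({1..} <+> {1..}) osum_less r w) =
    (if r \<in> shifted_shuffle (cpark w') (cpark w'') then 1 else 0 :: 'k::field)"
proof -
  let ?S = "{1..} <+> {1..} :: (nat + nat) set"
  let ?Sh = "shuffles (map (apfst Inl) w') (map (apfst Inr) w'')"
  \<comment> \<open>One letterwise map parks all words of the shuffle set, since the places depend
    only on the two restrictions.\<close>
  let ?h = "apfst (case_sum (place (map fst w')) (\<lambda>j. length w' + place (map fst w'') j)) ::
    (nat + nat) \<times> 'a \<Rightarrow> nat \<times> 'a"
  have set: "set w = apfst Inl ` set w' \<union> apfst Inr ` set w''" if "w \<in> ?Sh" for w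
    using set_shuffles[OF that] by simp
  have sub: "fst ` set w \<subseteq> ?S" if "w \<in> ?Sh" for w
    using assms by (auto simp: set[OF that])
  have G: "G_series ?S osum_less r w = (if map ?h w = biword r then 1 else 0 :: 'k)" if w: "w \<in> ?Sh" for w
  proof -
    have parts: "first_part w = w'" "second_part w = w''" using w parts_iff_shuffles by blast+
    have "park_place ?S osum_less (map fst w) x
        = case_sum (place (map fst w')) (\<lambda>j. length w' + place (map fst w'') j) x"
      if "x \<in> set (map fst w)" for x
      using park_place_osum[of "map fst w"] sub[OF w] that
      by (cases x) (auto simp: lefts_rights_first_second parts)
    hence "park_on ?S osum_less (map fst w) = map fst (map ?h w)"
      unfolding park_on_def by (simp add: o_def)
    moreover have "map snd w = map snd (map ?h w)" by simp
    moreover have "(map fst v, map snd v) = Rep_cpf r \<longleftrightarrow> v = biword r" for v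
      by (metis Rep_cpf_split(1) map_fst_biword map_snd_biword prod.inject zip_map_fst_snd)
    ultimately show ?thesis using sub[OF w] by (simp only: G_series_def simp_thms)
  qed
  have "inj_on (map ?h) ?Sh"
  proof (rule inj_onI)
    fix w1 w2 assume w: "w1 \<in> ?Sh" "w2 \<in> ?Sh" and eq: "map ?h w1 = map ?h w2"
    \<comment> \<open>After parking, the first copy occupies places up to \<open>length w'\<close>
      and the second copy larger ones, so the image still shows from which copy each letter
      comes.\<close>
    have P: "isl (fst z) \<longleftrightarrow> fst (?h z) \<le> length w'" if z: "z \<in> apfst Inl ` set w' \<union> apfst Inr ` set w''" for z
    proof -
      have "place (map fst w') x \<le> length w'" if "x \<in> fst ` set w'" for x
        using place_split_low(2)[of x "map fst w'" x] that
          order.trans[OF _ length_filter_le[of _ "map fst w'"]] by simp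
      moreover have "1 \<le> place (map fst w'') x" if "x \<in> fst ` set w''" for x
        using place_pos[of x "map fst w''"] that by simp
      ultimately show ?thesis using z by (force simp: Suc_le_eq)
    qed
    have m: "map (\<lambda>z. isl (fst z)) v = map (\<lambda>z. fst z \<le> length w') (map ?h v)" if "v \<in> ?Sh" for v
      using P unfolding set[OF that, symmetric] by simp
    have "map (\<lambda>z. isl (fst z)) w1 = map (\<lambda>z. isl (fst z)) w2" using m[OF w(1)] m[OF w(2)] eq by metis
    moreover have "first_part w1 = first_part w2" "second_part w1 = second_part w2"
      using w parts_iff_shuffles by metis+
    ultimately show "w1 = w2"
      by - (rule list_eq_by_partition[of "\<lambda>z. isl (fst z)"],
          simp_all only: map_first_part[symmetric] map_second_part[symmetric])
  qed
  from sum.reindex[OF this, of "\<lambda>v. if v = biword r then 1 else 0 :: 'k"]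
  have "(\<Sum>w\<in>?Sh. if map ?h w = biword r then 1 else 0 :: 'k)
      = (\<Sum>v\<in>map ?h ` ?Sh. if v = biword r then 1 else 0)"
    by (simp only: o_def)
  also have "\<dots> = (if biword r \<in> map ?h ` ?Sh then 1 else 0)"
    by simp
  also have "map ?h ` ?Sh = shuffles (map (?h \<circ> apfst Inl) w') (map (?h \<circ> apfst Inr) w'')"
    by (simp only: image_map_shuffles map_map)
  also have "map (?h \<circ> apfst Inl) w' = biword (cpark w')"
    by (simp add: biword_cpark[OF assms(1)] apfst_def map_prod_def split_beta)
  also have "map (?h \<circ> apfst Inr) w'' = map (\<lambda>(x, c). (x + cpf_size (cpark w'), c)) (biword (cpark w''))"
    by (simp add: biword_cpark[OF assms(2)] size_cpark[OF assms(1)] apfst_def map_prod_def split_beta add.commute)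
  finally show ?thesis using G by (simp add: shifted_shuffle_def)
qed

lemma realize_tensor_cut_sum: "realize_tensor (lin_ext cut_sum f) = realize_sum (f :: ('c, 'k::field) pqsym)"
proof (rule ext, clarify)
  fix w' w'' :: "(nat \<times> 'c) list"
  let ?Sh = "shuffles (map (apfst Inl) w') (map (apfst Inr) w'')"
  let ?G = "\<lambda>p w. G_series ({1..} <+> {1..}) osum_less p w :: 'k"
  have "realize_sum f (w', w'') = (\<Sum>w\<in>?Sh. \<Sum>p\<in>keys f. lookup f p * ?G p w)"
    by (simp add: realize_sum_def realize_def parts_iff_shuffles)
  also have "\<dots> = (\<Sum>p\<in>keys f. lookup f p * (\<Sum>w\<in>?Sh. ?G p w))"
    by (subst sum.swap) (simp add: sum_distrib_left)
  also have "\<dots> = realize_tensor (lin_ext cut_sum f) (w', w'')"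
  proof (cases "positive w' \<and> positive w''")
    case True
    thus ?thesis
      by (simp add: sum_G_series_shuffles realize_tensor_eq lin_ext_def lookup_sum lookup_scale
          lookup_cut_sum del: One_nat_def)
  next
    \<comment> \<open>A letter 0 belongs to neither alphabet, so both sides vanish.\<close>
    case False
    have "?G p w = 0" if "w \<in> ?Sh" for p w
      using False set_shuffles[OF that] by (force simp: G_series_def)
    hence "(\<Sum>p\<in>keys f. lookup f p * (\<Sum>w\<in>?Sh. ?G p w)) = 0" by simp
    thus ?thesis unfolding realize_tensor_eq if_not_P[OF False] .
  qed
  finally show "realize_tensor (lin_ext cut_sum f) (w', w'') = realize_sum f (w', w'')" ..
qed

text \<open>The coefficient of \<open>(p, q)\<close> is the value at their biwords, which parking
  leaves fixed. This is the uniqueness behind the description defining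
  \<open>pq_comult\<close>.\<close>

lemma realize_tensor_inject: "realize_tensor s = realize_tensor t \<longleftrightarrow> s = t"
proof
  assume eq: "realize_tensor s = realize_tensor t"
  have "lookup s (p, q) = lookup t (p, q)" for p q
    using fun_cong[OF eq, of "(biword p, biword q)"]
    by (simp add: realize_tensor_eq positive_biword cpark_biword del: One_nat_def)
  thus "s = t" by (intro poly_mapping_eqI) auto
qed simp

lemma pq_comult_eq: "pq_comult f = lin_ext cut_sum f"
  unfolding pq_comult_def
  by (rule the_equality) (simp_all only: realize_tensor_cut_sum[symmetric] realize_tensor_inject)

lemma pq_comult_bas: "pq_comult (bas r) = (\<Sum>k\<in>breaks r. bas (lcut k r) \<otimes> bas (rcut k r))"
  by (simp add: pq_comult_eq cut_sum_def tensor_bas)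

section \<open>The product\<close>

text \<open>Parking preserves length, so the factorization in the convolution can only occur at
  \<open>cpf_size p\<close>; stated on biwords, the condition takes care of the colors as
  well.\<close>

definition cconv :: "'c cpf \<Rightarrow> 'c cpf \<Rightarrow> 'c cpf set" where
  "cconv p q = {r. cpark (take (cpf_size p) (biword r)) = p \<and> cpark (drop (cpf_size p) (biword r)) = q}"

lemma positive_take: "positive w \<Longrightarrow> positive (take n w)"
  and positive_drop: "positive w \<Longrightarrow> positive (drop n w)"
  by (auto dest: in_set_takeD in_set_dropD)

lemma cconv_size: "r \<in> cconv p q \<Longrightarrow> cpf_size r = cpf_size p + cpf_size q"
proof -
  assume r: "r \<in> cconv p q"
  have "length (take (cpf_size p) (biword r)) = cpf_size p"
    "length (drop (cpf_size p) (biword r)) = cpf_size q"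
    using r size_cpark[OF positive_take[OF positive_biword], of "cpf_size p" r]
      size_cpark[OF positive_drop[OF positive_biword], of "cpf_size p" r]
    unfolding cconv_def by auto
  thus "cpf_size r = cpf_size p + cpf_size q"
    by (auto simp: length_biword)
qed

lemma finite_cconv: "finite (cconv p q :: 'c::finite cpf set)"
  by (rule finite_subset[OF _ finite_cpf_size[of "cpf_size p + cpf_size q"]]) (auto dest: cconv_size)

lemma convolution_cconv:
  "(\<Sum>a\<in>convolution (cpf_letters p) (cpf_letters q). f (Abs_cpf (a, cpf_colors p @ cpf_colors q)))
    = (\<Sum>r\<in>cconv p q. f r)"
proof (rule sum.reindex_bij_witness[of _ cpf_letters "\<lambda>a. Abs_cpf (a, cpf_colors p @ cpf_colors q)"])
  fix a assume "a \<in> convolution (cpf_letters p) (cpf_letters q)"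
  then obtain v w where a: "a = v @ w" "parking a" "park v = cpf_letters p" "park w = cpf_letters q"
    by (auto simp: convolution_def)
  have "set v \<subseteq> {1..}" "set w \<subseteq> {1..}" using parking_pos[OF a(2)] a(1) by auto
  hence len: "length v = cpf_size p" "length w = cpf_size q"
    using length_park[of v] length_park[of w] a by (simp_all add: cpf_size_def)
  let ?r = "Abs_cpf (a, cpf_colors p @ cpf_colors q)"
  have Rep: "Rep_cpf ?r = (a, cpf_colors p @ cpf_colors q)"
    using a len by (intro Abs_cpf_inverse) (simp add: Rep_cpf_split cpf_size_def)
  hence bi: "biword ?r = zip v (cpf_colors p) @ zip w (cpf_colors q)"
    using a len by (simp add: biword_def cpf_letters_def cpf_colors_def)
      (simp add: cpf_colors_def[symmetric] Rep_cpf_split cpf_size_def)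
  have [simp]: "length (cpf_colors p) = cpf_size p" "length (cpf_colors q) = cpf_size q"
    by (simp_all add: Rep_cpf_split cpf_size_def)
  show "?r \<in> cconv p q"
    using len a unfolding cconv_def mem_Collect_eq bi
    by (simp add: cpark_def Rep_cpf_split(1)[symmetric] Rep_cpf_inverse)
  show "cpf_letters ?r = a" using Rep by (simp add: cpf_letters_def)
next
  fix r assume r: "r \<in> cconv p q"
  let ?n = "cpf_size p"
  have "Rep_cpf p = (park (take ?n (cpf_letters r)), take ?n (cpf_colors r))"
    "Rep_cpf q = (park (drop ?n (cpf_letters r)), drop ?n (cpf_colors r))"
    using r Rep_cpf_cpark[OF positive_take[OF positive_biword], of ?n r]
      Rep_cpf_cpark[OF positive_drop[OF positive_biword], of ?n r]
    by (auto simp: cconv_def take_map[symmetric] drop_map[symmetric] map_fst_biword map_snd_biword)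
  hence eq: "park (take ?n (cpf_letters r)) = cpf_letters p" "park (drop ?n (cpf_letters r)) = cpf_letters q"
    "cpf_colors p = take ?n (cpf_colors r)" "cpf_colors q = drop ?n (cpf_colors r)"
    by (simp_all add: cpf_letters_def cpf_colors_def)
  show "cpf_letters r \<in> convolution (cpf_letters p) (cpf_letters q)"
    unfolding convolution_def mem_Collect_eq
    by (intro exI[of _ "take ?n (cpf_letters r)"] exI[of _ "drop ?n (cpf_letters r)"])
       (simp add: eq(1,2) Rep_cpf_split)
  show "Abs_cpf (cpf_letters r, cpf_colors p @ cpf_colors q) = r"
    by (simp add: eq(3,4) Rep_cpf_split(1)[symmetric] Rep_cpf_inverse)
qed simp

lemma pq_mult_lin_ext: "pq_mult x y = lin_ext (\<lambda>p. lin_ext (\<lambda>q. \<Sum>r\<in>cconv p q. bas r) y) x"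
  unfolding pq_mult_def lin_ext_def convolution_cconv[where f = "\<lambda>r. bas r"]
  by (simp add: FV.scale_sum_right)

lemma linear_pq_mult_left: "linear_map (\<lambda>x. pq_mult x y)"
  and linear_pq_mult_right: "linear_map (\<lambda>y. pq_mult x y)"
  unfolding pq_mult_lin_ext by (rule lin_ext_linear, rule lin_ext_linear_param, rule lin_ext_linear)

lemma pq_mult_bas: "pq_mult (bas p) (bas q) = (\<Sum>r\<in>cconv p q. bas r)"
  by (simp add: pq_mult_lin_ext)

section \<open>Associativity of the product\<close>

lemma cpark_part:
  assumes "mset v \<subseteq># mset w" "positive w"
  shows "cpark (map (apfst (place (map fst w))) v) = cpark v"
proof -
  have "mset (map fst v) \<subseteq># mset (map fst w)" using image_mset_subseteq_mono[OF assms(1), of fst] by simp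
  hence "park (map (place (map fst w)) (map fst v)) = park (map fst v)"
    using assms(2) by (intro park_map_place) auto
  thus ?thesis by (simp add: cpark_def o_def)
qed

lemma mset_take_drop_subset: "mset (take n w) \<subseteq># mset w" "mset (drop n w) \<subseteq># mset w"
  by (metis append_take_drop_id mset_append mset_subset_eq_add_left mset_subset_eq_add_right)+

text \<open>The comparison behind associativity: by \<open>park_map_place\<close>, parking the whole
  word first is invisible once a factor is parked.\<close>

lemma cpark_take_cpark: "positive w \<Longrightarrow> cpark (take n (biword (cpark w))) = cpark (take n w)"
  and cpark_drop_cpark: "positive w \<Longrightarrow> cpark (drop n (biword (cpark w))) = cpark (drop n w)"
  by (simp_all add: biword_cpark take_map drop_map cpark_part mset_take_drop_subset del: One_nat_def)

text \<open>Indexes both bracketings of a threefold product: the intermediate term is the parked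
  prefix or suffix of \<open>r\<close>, hence determined by \<open>r\<close>.\<close>

definition cconv3 :: "'c cpf \<Rightarrow> 'c cpf \<Rightarrow> 'c cpf \<Rightarrow> 'c cpf set" where
  "cconv3 p q s = {r. cpark (take (cpf_size p) (biword r)) = p \<and>
     cpark (take (cpf_size q) (drop (cpf_size p) (biword r))) = q \<and>
     cpark (drop (cpf_size p + cpf_size q) (biword r)) = s}"

lemma cconv_left_iff:
  "a \<in> cconv p q \<and> r \<in> cconv a s \<longleftrightarrow>
     r \<in> cconv3 p q s \<and> a = cpark (take (cpf_size p + cpf_size q) (biword r))"
proof -
  let ?n = "cpf_size p + cpf_size q"
  let ?a = "cpark (take ?n (biword r))"
  have pos: "positive (take ?n (biword r))" by (rule positive_take[OF positive_biword])
  have a: "?a \<in> cconv p q \<longleftrightarrow> cpark (take (cpf_size p) (biword r)) = p \<and>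
      cpark (take (cpf_size q) (drop (cpf_size p) (biword r))) = q"
    using cpark_take_cpark[OF pos, of "cpf_size p"] cpark_drop_cpark[OF pos, of "cpf_size p"]
    by (simp add: cconv_def drop_take)
  show ?thesis
  proof
    assume L: "a \<in> cconv p q \<and> r \<in> cconv a s"
    hence n: "cpf_size a = ?n" by (simp add: cconv_size)
    have s: "cpark (take ?n (biword r)) = a" "cpark (drop ?n (biword r)) = s"
      using L unfolding cconv_def[of a] n by simp_all
    show "r \<in> cconv3 p q s \<and> a = ?a"
      unfolding cconv3_def mem_Collect_eq using a L s by metis
  next
    assume R: "r \<in> cconv3 p q s \<and> a = ?a"
    hence L: "a \<in> cconv p q" using a by (simp only: cconv3_def mem_Collect_eq simp_thms)
    hence n: "cpf_size a = ?n" by (rule cconv_size)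
    have "r \<in> cconv a s"
      using R unfolding cconv_def[of a] n mem_Collect_eq cconv3_def by metis
    with L show "a \<in> cconv p q \<and> r \<in> cconv a s" ..
  qed
qed

lemma cconv_right_iff:
  "b \<in> cconv q s \<and> r \<in> cconv p b \<longleftrightarrow> r \<in> cconv3 p q s \<and> b = cpark (drop (cpf_size p) (biword r))"
proof -
  let ?b = "cpark (drop (cpf_size p) (biword r))"
  have pos: "positive (drop (cpf_size p) (biword r))" by (rule positive_drop[OF positive_biword])
  have b: "?b \<in> cconv q s \<longleftrightarrow> cpark (take (cpf_size q) (drop (cpf_size p) (biword r))) = q \<and>
      cpark (drop (cpf_size p + cpf_size q) (biword r)) = s"
    using cpark_take_cpark[OF pos, of "cpf_size q"] cpark_drop_cpark[OF pos, of "cpf_size q"]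
    by (simp add: cconv_def add.commute)
  have r: "r \<in> cconv p b \<longleftrightarrow> cpark (take (cpf_size p) (biword r)) = p \<and> ?b = b"
    by (simp add: cconv_def)
  show ?thesis unfolding r cconv3_def mem_Collect_eq using b by metis
qed

text \<open>The pairs form the graph of \<open>h\<close> on \<open>T\<close>, so their second
  component alone indexes them.\<close>

lemma sum_Sigma_graph:
  assumes "finite A" "\<And>a. a \<in> A \<Longrightarrow> finite (B a)"
    and "\<And>a r. a \<in> A \<and> r \<in> B a \<longleftrightarrow> r \<in> T \<and> a = h r"
  shows "(\<Sum>a\<in>A. \<Sum>r\<in>B a. f r) = (\<Sum>r\<in>T. f r)"
proof -
  have "(\<Sum>a\<in>A. \<Sum>r\<in>B a. f r) = (\<Sum>(a, r)\<in>Sigma A B. f r)"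
    using assms(1,2) by (intro sum.Sigma) auto
  also have "\<dots> = (\<Sum>r\<in>T. f r)"
  proof (rule sum.reindex_bij_witness[of _ "\<lambda>r. (h r, r)" snd])
    fix x assume "x \<in> Sigma A B"
    with assms(3)[of "fst x" "snd x"] show "(h (snd x), snd x) = x" "snd x \<in> T" by (cases x; auto)+
  next
    fix r assume "r \<in> T"
    with assms(3)[of "h r" r] show "(h r, r) \<in> Sigma A B" by simp
  qed auto
  finally show ?thesis .
qed

lemma pq_mult_assoc_bas:
  fixes p q s :: "'c::finite cpf"
  shows "pq_mult (pq_mult (bas p) (bas q)) (bas s) = pq_mult (bas p) (pq_mult (bas q) (bas s))"
  by (simp add: pq_mult_bas linear_map_sum[OF linear_pq_mult_left] linear_map_sum[OF linear_pq_mult_right]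
      sum_Sigma_graph[OF finite_cconv finite_cconv cconv_left_iff]
      sum_Sigma_graph[OF finite_cconv finite_cconv cconv_right_iff])

lemma pq_mult_assoc:
  fixes x y z :: "('c::finite, 'k::field) pqsym"
  shows "pq_mult (pq_mult x y) z = pq_mult x (pq_mult y z)"
proof (rule linear_map_eqI[of "\<lambda>x. pq_mult (pq_mult x y) z" "\<lambda>x. pq_mult x (pq_mult y z)"])
  fix p
  show "pq_mult (pq_mult (bas p) y) z = pq_mult (bas p) (pq_mult y z)"
  proof (rule linear_map_eqI[of "\<lambda>y. pq_mult (pq_mult (bas p) y) z" "\<lambda>y. pq_mult (bas p) (pq_mult y z)"])
    fix q
    show "pq_mult (pq_mult (bas p) (bas q)) z = pq_mult (bas p) (pq_mult (bas q) z)"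
      by (rule linear_map_eqI[of "\<lambda>z. pq_mult (pq_mult (bas p) (bas q)) z"
            "\<lambda>z. pq_mult (bas p) (pq_mult (bas q) z)"])
         (intro linear_pq_mult_right linear_map_compose[OF linear_pq_mult_right] pq_mult_assoc_bas)+
  qed (intro linear_map_compose[OF linear_pq_mult_left] linear_map_compose[OF linear_pq_mult_right]
        linear_pq_mult_right linear_pq_mult_left)+
qed (intro linear_map_compose[OF linear_pq_mult_left] linear_pq_mult_left)+

section \<open>The unit\<close>

lemma pq_one_eq: "pq_one = bas cpf_empty"
  by (simp add: pq_one_def cpf_empty_def)

lemma cconv_empty: "cconv cpf_empty q = {q}" "cconv p cpf_empty = {p}"
proof -
  show "cconv cpf_empty q = {q}"
    by (auto simp: cconv_def cpf_empty cpark_biword cpf_empty_cpark[symmetric])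
  have "r = p" if "r \<in> cconv p cpf_empty" for r
    using cconv_size[OF that] that by (simp add: cpf_empty cconv_def length_biword cpark_biword)
  moreover have "p \<in> cconv p cpf_empty"
    by (simp add: cconv_def length_biword cpark_biword cpf_empty_cpark)
  ultimately show "cconv p cpf_empty = {p}" by blast
qed

lemma pq_mult_one_left: "pq_mult pq_one x = x"
  unfolding pq_one_eq
  by (rule linear_map_eqI[OF linear_pq_mult_right linear_map_id(1)]) (simp add: pq_mult_bas cconv_empty)

lemma pq_mult_one_right: "pq_mult x pq_one = x"
  unfolding pq_one_eq
  by (rule linear_map_eqI[OF linear_pq_mult_left linear_map_id(1)]) (simp add: pq_mult_bas cconv_empty)

section \<open>Compatibility of product and coproduct\<close>

text \<open>Sparseness lets the letters up to \<open>k\<close> and above \<open>k\<close> be parked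
  separately, so parking moves the cut from \<open>k\<close> to the number \<open>i\<close> of
  letters up to \<open>k\<close> and preserves which letters lie below it.\<close>

lemma sparse_split:
  assumes v: "positive v" "sparse_below k (map fst v)"
  defines "i \<equiv> length (low k v)"
  shows "i \<in> breaks (cpark v)"
    and "lcut i (cpark v) = cpark (low k v)"
    and "rcut i (cpark v) = cpark (high k v)"
    and "map (\<lambda>z. fst z \<le> i) (biword (cpark v)) = map (\<lambda>z. fst z \<le> k) v"
proof -
  let ?f = "place (map fst v)"
  let ?l = "place (map fst (low k v))" and ?h = "place (map fst (high k v))"
  have lo: "?f x = ?l x" "?f x \<le> i" if "x \<in> set (map fst v)" "x \<le> k" for x
    using place_split_low[OF that] unfolding i_def length_low map_fst_low by auto
  have hi: "?f x = i + ?h (x - k)" if "x \<in> set (map fst v)" "k < x" for x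
    using place_split_high[OF v(2) that] unfolding i_def length_low map_fst_high by simp
  have hi': "i < ?f x" if "x \<in> set (map fst v)" "k < x" for x
  proof -
    have "x - k \<in> set (map fst (high k v))" using that by force
    from place_pos[OF this] hi[OF that] show ?thesis by simp
  qed
  have iff: "?f (fst z) \<le> i \<longleftrightarrow> fst z \<le> k" if "z \<in> set v" for z
    using that lo(2)[of "fst z"] hi'[of "fst z"] by (cases "fst z \<le> k") auto
  have bi: "biword (cpark v) = map (apfst ?f) v" by (rule biword_cpark[OF v(1)])
  show "map (\<lambda>z. fst z \<le> i) (biword (cpark v)) = map (\<lambda>z. fst z \<le> k) v"
    using iff by (simp add: bi)
  have "low i (biword (cpark v)) = map (apfst ?f) (low k v)"
    unfolding bi filter_map o_def using iff by (intro arg_cong[of _ _ "map _"] filter_cong) auto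
  also have "\<dots> = map (apfst ?l) (low k v)"
    using lo(1) by (intro map_cong) auto
  also have "\<dots> = biword (cpark (low k v))"
    by (rule biword_cpark[OF positive_low[OF v(1)], symmetric])
  finally have L: "low i (biword (cpark v)) = biword (cpark (low k v))" .
  thus "lcut i (cpark v) = cpark (low k v)" by (simp add: lcut_def cpark_biword)
  have "length (low i (biword (cpark v))) = i"
    unfolding L length_biword size_cpark[OF positive_low[OF v(1)]] by (simp add: i_def)
  thus "i \<in> breaks (cpark v)" by (simp add: breaks_def)
  have "high i (biword (cpark v)) = map (apfst (\<lambda>x. ?f x - i)) (filter (\<lambda>z. k < fst z) v)"
    unfolding bi filter_map map_map o_def apfst_compose using iff
    by (intro map_cong filter_cong) (auto simp: not_le[symmetric])
  also have "\<dots> = map (apfst ?h) (high k v)"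
  proof -
    have "?f x - i = ?h (x - k)" if "(x, y) \<in> set v" "k < x" for x y
      using hi[of x] that by force
    thus ?thesis unfolding map_map[of "apfst ?h"] by (intro map_cong) auto
  qed
  also have "\<dots> = biword (cpark (high k v))"
    by (rule biword_cpark[OF positive_high, symmetric])
  finally show "rcut i (cpark v) = cpark (high k v)" by (simp add: rcut_def cpark_biword)
qed

lemma high_restore: "map (apfst (\<lambda>x. x + k)) (high k w) = filter (\<lambda>z. \<not> fst z \<le> k) w"
  by (induction w) (auto simp: not_le)

lemma word_eq_by_cuts:
  assumes "map (\<lambda>z. fst z \<le> k) w = map (\<lambda>z. fst z \<le> k) w'" "low k w = low k w'" "high k w = high k w'"
  shows "w = w'"
  using assms(1,2) by (rule list_eq_by_partition) (simp only: high_restore[symmetric] assms(3))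

text \<open>Serves twice: for the injectivity in \<open>sum_cconv_breaks\<close>, and in
  \<open>cconv_breaks_surj\<close> to recognize the parked factors of the constructed word as
  \<open>p\<close> and \<open>q\<close>.\<close>

lemma cpf_eq_by_cuts:
  assumes "i \<in> breaks p" "i \<in> breaks p'" "lcut i p = lcut i p'" "rcut i p = rcut i p'"
    "map (\<lambda>z. fst z \<le> i) (biword p) = map (\<lambda>z. fst z \<le> i) (biword p')"
  shows "p = p'"
  unfolding biword_inject[symmetric] using assms(5)
  by (rule word_eq_by_cuts) (metis assms(1-4) biword_lcut biword_rcut)+

text \<open>The existence counterpart of \<open>list_eq_by_partition\<close>: \<open>bs\<close>
  prescribes which of the two words supplies the next letter.\<close>

lemma ex_merge:
  assumes "length (filter (\<lambda>b. b) bs) = length xs" "length (filter (\<lambda>b. \<not> b) bs) = length ys"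
    "\<forall>x\<in>set xs. P x" "\<forall>y\<in>set ys. \<not> P y"
  shows "\<exists>z. map P z = bs \<and> filter P z = xs \<and> filter (\<lambda>x. \<not> P x) z = ys"
  using assms
proof (induction bs arbitrary: xs ys)
  case (Cons b bs)
  show ?case
  proof (cases b)
    case True
    with Cons.prems obtain x xs' where "xs = x # xs'" by (cases xs) auto
    with Cons.prems Cons.IH[of xs' ys] True obtain z
      where "map P z = bs \<and> filter P z = xs' \<and> filter (\<lambda>x. \<not> P x) z = ys" by auto
    with \<open>xs = x # xs'\<close> Cons.prems True show ?thesis by (intro exI[of _ "x # z"]) auto
  next
    case False
    with Cons.prems obtain y ys' where "ys = y # ys'" by (cases ys) auto
    with Cons.prems Cons.IH[of xs ys'] False obtain z
      where "map P z = bs \<and> filter P z = xs \<and> filter (\<lambda>x. \<not> P x) z = ys'" by auto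
    with \<open>ys = y # ys'\<close> Cons.prems False show ?thesis by (intro exI[of _ "y # z"]) auto
  qed
qed simp

text \<open>The factors \<open>v\<close> and \<open>w\<close> need not be parking functions, so
  \<open>k\<close> itself need not be a break of \<open>p\<close> or \<open>q\<close>. As parts of
  \<open>r\<close> both are sparse below \<open>k\<close>, and \<open>sparse_split\<close> yields
  the breaks \<open>i\<close> and \<open>j\<close> of their parkizations.\<close>

lemma cconv_breaks:
  fixes p q r :: "'c cpf" and k :: nat
  assumes r: "r \<in> cconv p q" and k: "k \<in> breaks r"
  defines "v \<equiv> take (cpf_size p) (biword r)" and "w \<equiv> drop (cpf_size p) (biword r)"
  defines "i \<equiv> length (low k v)" and "j \<equiv> length (low k w)"
  shows "k = i + j" "i \<in> breaks p" "j \<in> breaks q"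
    and "lcut k r \<in> cconv (lcut i p) (lcut j q)" "rcut k r \<in> cconv (rcut i p) (rcut j q)"
    and "map (\<lambda>z. fst z \<le> k) (biword r) =
      map (\<lambda>z. fst z \<le> i) (biword p) @ map (\<lambda>z. fst z \<le> j) (biword q)"
proof -
  have vw: "biword r = v @ w" "cpark v = p" "cpark w = q"
    using r by (simp_all add: v_def w_def cconv_def)
  have pos: "positive v" "positive w"
    unfolding v_def w_def by (intro positive_take positive_drop positive_biword)+
  have "sparse_below k (map fst (biword r))"
    using length_low_breaks[OF k] unfolding length_low by (rule parking_sparse_below[OF parking_biword])
  hence sp: "sparse_below k (map fst v)" "sparse_below k (map fst w)"
    unfolding v_def w_def take_map[symmetric] drop_map[symmetric]
    by (rule sparse_below_mset_mono[rotated], intro mset_take_drop_subset)+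
  note V = sparse_split[OF pos(1) sp(1), folded i_def, unfolded vw(2)]
  note W = sparse_split[OF pos(2) sp(2), folded j_def, unfolded vw(3)]
  show kij: "k = i + j" using length_low_breaks[OF k] by (simp add: vw(1) i_def j_def)
  show "i \<in> breaks p" "j \<in> breaks q" by (rule V W)+
  have "cpf_size (lcut i p) = length (low k v)"
    unfolding V(2) by (rule size_cpark[OF positive_low[OF pos(1)]])
  moreover have "biword (lcut k r) = low k v @ low k w"
    by (simp add: biword_lcut[OF k] vw(1))
  ultimately show "lcut k r \<in> cconv (lcut i p) (lcut j q)"
    unfolding cconv_def by (simp add: V(2) W(2))
  have "cpf_size (rcut i p) = length (high k v)"
    unfolding V(3) by (rule size_cpark[OF positive_high])
  moreover have "biword (rcut k r) = high k v @ high k w"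
    by (simp add: biword_rcut[OF k] vw(1))
  ultimately show "rcut k r \<in> cconv (rcut i p) (rcut j q)"
    unfolding cconv_def by (simp add: V(3) W(3))
  show "map (\<lambda>z. fst z \<le> k) (biword r) =
      map (\<lambda>z. fst z \<le> i) (biword p) @ map (\<lambda>z. fst z \<le> j) (biword q)"
    by (simp add: vw(1) V(4) W(4))
qed

lemma cconv_breaks_surj:
  fixes p q b c :: "'c cpf"
  assumes i: "i \<in> breaks p" and j: "j \<in> breaks q"
    and b: "b \<in> cconv (lcut i p) (lcut j q)" and c: "c \<in> cconv (rcut i p) (rcut j q)"
  obtains r k where "r \<in> cconv p q" "k \<in> breaks r" "lcut k r = b" "rcut k r = c"
    "length (low k (take (cpf_size p) (biword r))) = i"
    "length (low k (drop (cpf_size p) (biword r))) = j"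
proof -
  define k where "k = i + j"
  let ?P = "\<lambda>z :: nat \<times> 'c. fst z \<le> k"
  let ?bp = "map (\<lambda>z. fst z \<le> i) (biword p)" and ?bq = "map (\<lambda>z. fst z \<le> j) (biword q)"
  have cnt: "length (filter (\<lambda>b. b) ?bp) = i" "length (filter (\<lambda>b. b) ?bq) = j"
    using length_low_breaks[OF i] length_low_breaks[OF j] by (simp_all add: filter_map o_def)
  have cnt': "length (filter (\<lambda>b. \<not> b) ?bp) = cpf_size (rcut i p)"
    "length (filter (\<lambda>b. \<not> b) ?bq) = cpf_size (rcut j q)"
    by (simp_all add: length_biword[symmetric] biword_rcut i j filter_map o_def not_le)
  have sb: "cpf_size b = k" using cconv_size[OF b] by (simp add: size_lcut i j k_def)
  let ?ys = "map (apfst (\<lambda>x. x + k)) (biword c)"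
  \<comment> \<open>The last claim of \<open>cconv_breaks\<close> forces the pattern: that of
    \<open>p\<close> at \<open>i\<close> followed by that of \<open>q\<close> at \<open>j\<close>.
    The low letters are then taken from \<open>b\<close>, the others from \<open>c\<close> shifted
    by \<open>k\<close>.\<close>
  have "\<exists>W. map ?P W = ?bp @ ?bq \<and> filter ?P W = biword b \<and> filter (\<lambda>z. \<not> ?P z) W = ?ys"
  proof (rule ex_merge)
    show "length (filter (\<lambda>b. b) (?bp @ ?bq)) = length (biword b)"
      unfolding filter_append length_append cnt by (simp add: length_biword sb k_def)
    show "length (filter (\<lambda>b. \<not> b) (?bp @ ?bq)) = length ?ys"
      unfolding filter_append length_append cnt' by (simp add: length_biword cconv_size[OF c])
    show "\<forall>x\<in>set (biword b). ?P x"
      using parking_biword[of b] unfolding parking_def length_map length_biword sb by force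
    show "\<forall>y\<in>set ?ys. \<not> ?P y" using positive_biword[of c] by force
  qed
  then obtain W where W: "map ?P W = ?bp @ ?bq" "low k W = biword b" "filter (\<lambda>z. \<not> ?P z) W = ?ys"
    by blast
  have hi: "high k W = biword c"
    using W(3) by (auto simp: not_le o_def apfst_compose intro!: map_idI)
  have lenk: "length (low k W) = k" by (simp add: W(2) length_biword sb)
  \<comment> \<open>Exactly \<open>k\<close> letters of \<open>W\<close> are at most
    \<open>k\<close>, and its low and high words are the parking functions of \<open>b\<close> and
    \<open>c\<close>.\<close>
  have "parking (map fst W)"
    unfolding parking_colored_split[OF lenk] W(2) hi by (simp add: parking_biword)
  define r where "r = cpark W"
  have r: "biword r = W" unfolding r_def by (rule biword_cpark_parking) fact
  have k: "k \<in> breaks r" using lenk by (simp add: breaks_def r)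
  have cuts: "lcut k r = b" "rcut k r = c"
    by (simp_all add: lcut_def rcut_def r W(2) hi cpark_biword)
  define v where "v = take (cpf_size p) W"
  define w where "w = drop (cpf_size p) W"
  have Wvw: "W = v @ w" by (simp add: v_def w_def)
  have pat: "map ?P v = ?bp" "map ?P w = ?bq"
    unfolding v_def w_def take_map[symmetric] drop_map[symmetric] W(1) by (simp_all add: length_biword)
  have len: "length (low k v) = i" "length (low k w) = j"
    using cnt unfolding pat[symmetric] by (simp_all add: filter_map o_def)
  have "biword b = low k v @ low k w" using W(2) Wvw by simp
  hence lowvw: "cpark (low k v) = lcut i p" "cpark (low k w) = lcut j q"
    using b len by (simp_all add: cconv_def size_lcut i)
  have "length (high k v) = cpf_size (rcut i p)"
    using cnt'(1) unfolding pat(1)[symmetric] by (simp add: filter_map o_def not_le)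
  moreover have "biword c = high k v @ high k w" using hi Wvw by simp
  ultimately have highvw: "cpark (high k v) = rcut i p" "cpark (high k w) = rcut j q"
    using c by (simp_all add: cconv_def)
  have pos: "positive v" "positive w"
    unfolding v_def w_def r[symmetric] by (intro positive_take positive_drop positive_biword)+
  have "sparse_below k (map fst (biword r))"
    using length_low_breaks[OF k] unfolding length_low by (rule parking_sparse_below[OF parking_biword])
  hence sp: "sparse_below k (map fst v)" "sparse_below k (map fst w)"
    unfolding v_def w_def r[symmetric] take_map[symmetric] drop_map[symmetric]
    by (rule sparse_below_mset_mono[rotated], intro mset_take_drop_subset)+
  \<comment> \<open>The parts of \<open>cpark v\<close> at \<open>i\<close> and its pattern agree
    with those of \<open>p\<close>, which forces \<open>cpark v = p\<close>; likewise for
    \<open>w\<close> and \<open>q\<close>.\<close>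
  note V = sparse_split[OF pos(1) sp(1), unfolded len lowvw highvw pat]
  note W' = sparse_split[OF pos(2) sp(2), unfolded len lowvw highvw pat]
  have "cpark v = p" using cpf_eq_by_cuts[OF V(1) i V(2,3,4)] .
  moreover have "cpark w = q" using cpf_eq_by_cuts[OF W'(1) j W'(2,3,4)] .
  ultimately have "r \<in> cconv p q" by (simp add: cconv_def r v_def w_def)
  thus ?thesis using k cuts len that[of r k] by (simp add: r v_def w_def)
qed

text \<open>The bijection sends a term \<open>r\<close> of the product and a break \<open>k\<close> of \<open>r\<close> to the numbers of
  letters up to \<open>k\<close> in the two factors of \<open>r\<close>, together with the two cuts of \<open>r\<close> at \<open>k\<close>.\<close>

lemma sum_cconv_breaks:
  fixes p q :: "'c::finite cpf" and f :: "'c cpf \<Rightarrow> 'c cpf \<Rightarrow> 'm::comm_monoid_add"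
  shows "(\<Sum>r\<in>cconv p q. \<Sum>k\<in>breaks r. f (lcut k r) (rcut k r)) =
    (\<Sum>i\<in>breaks p. \<Sum>j\<in>breaks q. \<Sum>b\<in>cconv (lcut i p) (lcut j q).
       \<Sum>c\<in>cconv (rcut i p) (rcut j q). f b c)"
proof -
  let ?A = "SIGMA r:cconv p q. breaks r"
  let ?C = "\<lambda>(i, j). cconv (lcut i p) (lcut j q) \<times> cconv (rcut i p) (rcut j q)"
  let ?B = "SIGMA ij:breaks p \<times> breaks q. ?C ij"
  let ?g = "\<lambda>(r, k). ((length (low k (take (cpf_size p) (biword r))),
     length (low k (drop (cpf_size p) (biword r)))), (lcut k r, rcut k r))"
  have "bij_betw ?g ?A ?B"
  proof (rule bij_betw_imageI)
    show "inj_on ?g ?A"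
    proof (rule inj_onI, clarify)
      fix r k r' k'
      assume r: "r \<in> cconv p q" "k \<in> breaks r" "r' \<in> cconv p q" "k' \<in> breaks r'"
        and eq: "lcut k r = lcut k' r'" "rcut k r = rcut k' r'"
          "length (low k (take (cpf_size p) (biword r))) = length (low k' (take (cpf_size p) (biword r')))"
          "length (low k (drop (cpf_size p) (biword r))) = length (low k' (drop (cpf_size p) (biword r')))"
      \<comment> \<open>The break is the sum of the two counts. These counts, with \<open>p\<close>
        and \<open>q\<close>, also fix the pattern, and then the cuts fix \<open>r\<close>.\<close>
      have kk: "k = k'" using cconv_breaks(1)[OF r(1,2)] cconv_breaks(1)[OF r(3,4)] eq by simp
      have "map (\<lambda>z. fst z \<le> k) (biword r) = map (\<lambda>z. fst z \<le> k) (biword r')"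
        using cconv_breaks(6)[OF r(1,2)] cconv_breaks(6)[OF r(3,4)] eq kk by simp
      with r eq kk show "r = r' \<and> k = k'" using cpf_eq_by_cuts[of k r r'] by simp
    qed
    show "?g ` ?A = ?B"
    proof
      show "?g ` ?A \<subseteq> ?B" by (auto simp: cconv_breaks)
      show "?B \<subseteq> ?g ` ?A"
      proof clarify
        fix i j b c
        assume "i \<in> breaks p" "j \<in> breaks q"
          "b \<in> cconv (lcut i p) (lcut j q)" "c \<in> cconv (rcut i p) (rcut j q)"
        then obtain r k where "r \<in> cconv p q" "k \<in> breaks r" "lcut k r = b" "rcut k r = c"
          "length (low k (take (cpf_size p) (biword r))) = i"
          "length (low k (drop (cpf_size p) (biword r))) = j"
          by (rule cconv_breaks_surj)
        thus "((i, j), (b, c)) \<in> ?g ` ?A" by (intro image_eqI[of _ _ "(r, k)"]) auto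
      qed
    qed
  qed
  from sum.reindex_bij_betw[OF this, of "\<lambda>(ij, b, c). f b c"]
  have "(\<Sum>(r, k)\<in>?A. f (lcut k r) (rcut k r)) = (\<Sum>(ij, b, c)\<in>?B. f b c)"
    by (simp add: case_prod_unfold)
  also have "\<dots> = (\<Sum>ij\<in>breaks p \<times> breaks q. \<Sum>(b, c)\<in>?C ij. f b c)"
    by (rule sum.Sigma[symmetric]) (auto simp: finite_breaks finite_cconv)
  also have "\<dots> = (\<Sum>i\<in>breaks p. \<Sum>j\<in>breaks q. \<Sum>b\<in>cconv (lcut i p) (lcut j q).
       \<Sum>c\<in>cconv (rcut i p) (rcut j q). f b c)"
    by (simp add: sum.cartesian_product case_prod_unfold)
  also have "(\<Sum>(r, k)\<in>?A. f (lcut k r) (rcut k r)) = (\<Sum>r\<in>cconv p q. \<Sum>k\<in>breaks r. f (lcut k r) (rcut k r))"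
    by (rule sum.Sigma[symmetric]) (auto simp: finite_breaks finite_cconv)
  finally show ?thesis .
qed

lemma linear_pq_comult: "linear_map pq_comult"
  unfolding pq_comult_eq by (rule lin_ext_linear)

lemma pq_comult_bas_pair: "pq_comult (bas r) = (\<Sum>k\<in>breaks r. bas (lcut k r, rcut k r))"
  by (simp add: pq_comult_bas tensor_bas)

lemma pq_comult_mult_bas:
  fixes p q :: "'c::finite cpf"
  shows "pq_comult (pq_mult (bas p) (bas q)) = tensor_mult pq_mult (pq_comult (bas p)) (pq_comult (bas q))"
proof -
  have "pq_comult (pq_mult (bas p) (bas q)) = (\<Sum>r\<in>cconv p q. \<Sum>k\<in>breaks r. bas (lcut k r, rcut k r))"
    by (simp add: pq_mult_bas linear_map_sum[OF linear_pq_comult] pq_comult_bas_pair)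
  also have "\<dots> = (\<Sum>i\<in>breaks p. \<Sum>j\<in>breaks q. \<Sum>b\<in>cconv (lcut i p) (lcut j q).
       \<Sum>c\<in>cconv (rcut i p) (rcut j q). bas (b, c))"
    by (rule sum_cconv_breaks)
  also have "\<dots> = (\<Sum>i\<in>breaks p. \<Sum>j\<in>breaks q.
      pq_mult (bas (lcut i p)) (bas (lcut j q)) \<otimes> pq_mult (bas (rcut i p)) (bas (rcut j q)))"
    by (simp add: pq_mult_bas tensor_sum tensor_bas)
  also have "\<dots> = (\<Sum>i\<in>breaks p. \<Sum>j\<in>breaks q.
      tensor_mult pq_mult (bas (lcut i p, rcut i p)) (bas (lcut j q, rcut j q)))"
    by (simp add: tensor_mult_lin_ext)
  also have "\<dots> = tensor_mult pq_mult (pq_comult (bas p)) (pq_comult (bas q))"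
    by (simp add: pq_comult_bas_pair linear_map_sum[OF linear_tensor_mult_left]
        linear_map_sum[OF linear_tensor_mult_right] sum.swap[of _ "breaks p"])
  finally show ?thesis .
qed

lemma pq_comult_mult:
  fixes x y :: "('c::finite, 'k::field) pqsym"
  shows "pq_comult (pq_mult x y) = tensor_mult pq_mult (pq_comult x) (pq_comult y)"
proof (rule linear_map_eqI[of "\<lambda>x. pq_comult (pq_mult x y)" "\<lambda>x. tensor_mult pq_mult (pq_comult x) (pq_comult y)"])
  fix p
  show "pq_comult (pq_mult (bas p) y) = tensor_mult pq_mult (pq_comult (bas p)) (pq_comult y)"
    by (rule linear_map_eqI[of "\<lambda>y. pq_comult (pq_mult (bas p) y)"
          "\<lambda>y. tensor_mult pq_mult (pq_comult (bas p)) (pq_comult y)"])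
       (rule linear_map_compose[OF linear_pq_comult linear_pq_mult_right]
         linear_map_compose[OF linear_tensor_mult_right linear_pq_comult] pq_comult_mult_bas)+
qed (rule linear_map_compose[OF linear_pq_comult linear_pq_mult_left]
      linear_map_compose[OF linear_tensor_mult_left linear_pq_comult])+

section \<open>Coassociativity\<close>

lemma sum_breaks_assoc:
  fixes f :: "'c cpf \<Rightarrow> 'c cpf \<Rightarrow> 'c cpf \<Rightarrow> 'm::comm_monoid_add"
  shows "(\<Sum>k\<in>breaks r. \<Sum>j\<in>breaks (lcut k r). f (lcut j (lcut k r)) (rcut j (lcut k r)) (rcut k r)) =
    (\<Sum>j\<in>breaks r. \<Sum>i\<in>breaks (rcut j r). f (lcut j r) (lcut i (rcut j r)) (rcut i (rcut j r)))"
    (is "(\<Sum>k\<in>_. \<Sum>j\<in>_. ?L k j) = (\<Sum>j\<in>_. \<Sum>i\<in>_. ?R j i)")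
proof -
  have "(\<Sum>k\<in>breaks r. \<Sum>j\<in>breaks (lcut k r). ?L k j)
      = (\<Sum>(k, j)\<in>(SIGMA k:breaks r. breaks (lcut k r)). ?L k j)"
    by (rule sum.Sigma) (auto simp: finite_breaks)
  \<comment> \<open>Two breaks \<open>j \<le> k\<close> of \<open>r\<close> give a cut at
    \<open>k\<close> followed by \<open>j\<close> in the left part, or a cut at \<open>j\<close>
    followed by \<open>k - j\<close> in the right part. The summand is arbitrary because the
    comparison of the two antipodes uses the same exchange.\<close>
  also have "\<dots> = (\<Sum>(j, i)\<in>(SIGMA j:breaks r. breaks (rcut j r)). ?R j i)"
    by (rule sum.reindex_bij_witness[of _ "\<lambda>(j, i). (i + j, j)" "\<lambda>(k, j). (j, k - j)"])
       (auto simp: breaks_lcut breaks_rcut lcut_lcut rcut_rcut lcut_rcut)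
  also have "\<dots> = (\<Sum>j\<in>breaks r. \<Sum>i\<in>breaks (rcut j r). ?R j i)"
    by (rule sum.Sigma[symmetric]) (auto simp: finite_breaks)
  finally show ?thesis .
qed

lemma linear_tensor_map: "linear_map (tensor_map f g)"
  and linear_tensor_assoc: "linear_map tensor_assoc"
  unfolding tensor_map_def tensor_assoc_def by (rule lin_ext_linear)+

lemma pq_comult_coassoc:
  "tensor_assoc (tensor_map pq_comult id (pq_comult x)) = tensor_map id pq_comult (pq_comult x)"
proof (rule linear_map_eqI[of "\<lambda>x. tensor_assoc (tensor_map pq_comult id (pq_comult x))"
      "\<lambda>x. tensor_map id pq_comult (pq_comult x)"])
  fix r :: "'a cpf"
  have "tensor_assoc (tensor_map pq_comult id (pq_comult (bas r))) =
      (\<Sum>k\<in>breaks r. \<Sum>j\<in>breaks (lcut k r).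
        bas (lcut j (lcut k r), rcut j (lcut k r), rcut k r) :: _ \<Rightarrow>\<^sub>0 'b)"
    by (simp add: pq_comult_bas_pair linear_map_sum[OF linear_tensor_map]
        linear_map_sum[OF linear_tensor_assoc] linear_map_sum[OF linear_tensor_left]
        tensor_map_def tensor_bas linear_map_sum[OF lin_ext_linear] tensor_assoc_def)
  also have "\<dots> = (\<Sum>j\<in>breaks r. \<Sum>i\<in>breaks (rcut j r).
        bas (lcut j r, lcut i (rcut j r), rcut i (rcut j r)))"
    by (rule sum_breaks_assoc)
  also have "\<dots> = tensor_map id pq_comult (pq_comult (bas r))"
    by (simp add: pq_comult_bas_pair linear_map_sum[OF linear_tensor_right]
        tensor_map_def tensor_bas linear_map_sum[OF lin_ext_linear])
  finally show "tensor_assoc (tensor_map pq_comult id (pq_comult (bas r))) =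
      (tensor_map id pq_comult (pq_comult (bas r)) :: _ \<Rightarrow>\<^sub>0 'b)" .
qed (intro linear_map_compose[OF linear_tensor_assoc] linear_map_compose[OF linear_tensor_map]
      linear_pq_comult)+

section \<open>The counit\<close>

lemma lcut_eq_empty: "k \<in> breaks r \<Longrightarrow> lcut k r = cpf_empty \<longleftrightarrow> k = 0"
  by (simp add: cpf_size_0_iff[symmetric] size_lcut)

lemma rcut_eq_empty: "k \<in> breaks r \<Longrightarrow> rcut k r = cpf_empty \<longleftrightarrow> k = cpf_size r"
  using breaks_le[of k r] by (auto simp: cpf_size_0_iff[symmetric] size_rcut)

lemma sum_breaks_lcut_empty:
  "(\<Sum>k\<in>breaks r. if lcut k r = cpf_empty then f k else 0) = (f 0 :: 'm::comm_monoid_add)"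
proof -
  have "(\<Sum>k\<in>breaks r. if lcut k r = cpf_empty then f k else 0) = (\<Sum>k\<in>breaks r. if k = 0 then f k else 0)"
    by (intro sum.cong) (auto simp: lcut_eq_empty)
  thus ?thesis by (simp add: finite_breaks zero_breaks)
qed

lemma sum_breaks_rcut_empty:
  "(\<Sum>k\<in>breaks r. if rcut k r = cpf_empty then f k else 0) = (f (cpf_size r) :: 'm::comm_monoid_add)"
proof -
  have "(\<Sum>k\<in>breaks r. if rcut k r = cpf_empty then f k else 0)
      = (\<Sum>k\<in>breaks r. if k = cpf_size r then f k else 0)"
    by (intro sum.cong) (auto simp: rcut_eq_empty)
  thus ?thesis by (simp add: finite_breaks size_breaks)
qed

lemma pq_counit_eq: "pq_counit x = lookup x cpf_empty"
  by (simp add: pq_counit_def cpf_empty_def)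

lemma linear_pq_counit: "Vector_Spaces.linear scale (*) (pq_counit :: ('c, 'k::field) pqsym \<Rightarrow> 'k)"
proof -
  have "vector_space ((*) :: 'k \<Rightarrow> 'k \<Rightarrow> 'k)" by unfold_locales (auto simp: algebra_simps)
  thus ?thesis by (simp add: linear_iff_scale pq_counit_eq lookup_add lookup_scale)
qed

lemma pq_counit_bas: "pq_counit (bas p) = (if p = cpf_empty then 1 else 0)"
  by (simp add: pq_counit_eq lookup_bas)

lemma scale_if: "scale (if b then 1 else 0) x = (if b then x else 0)"
  by simp

lemma pq_counit_left: "lin_ext (\<lambda>(a, b). scale (pq_counit (bas a)) (bas b)) (pq_comult x) = x"
  by (rule linear_map_eqI[of "\<lambda>x. lin_ext _ (pq_comult x)" "\<lambda>x. x"])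
     (simp_all add: linear_map_compose[OF lin_ext_linear linear_pq_comult] linear_map_id
       pq_comult_bas_pair linear_map_sum[OF lin_ext_linear] pq_counit_bas scale_if
       sum_breaks_lcut_empty rcut_0 del: FV.scale_eq_0_iff)

lemma pq_counit_right: "lin_ext (\<lambda>(a, b). scale (pq_counit (bas b)) (bas a)) (pq_comult x) = x"
  by (rule linear_map_eqI[of "\<lambda>x. lin_ext _ (pq_comult x)" "\<lambda>x. x"])
     (simp_all add: linear_map_compose[OF lin_ext_linear linear_pq_comult] linear_map_id
       pq_comult_bas_pair linear_map_sum[OF lin_ext_linear] pq_counit_bas scale_if
       sum_breaks_rcut_empty lcut_size)

text \<open>Sizes add under convolution, so the empty term arises only from two empty factors; this
  makes the counit multiplicative.\<close>

lemma empty_in_cconv: "cpf_empty \<in> cconv p q \<longleftrightarrow> p = cpf_empty \<and> q = cpf_empty"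
  using cconv_size[of cpf_empty p q] by (auto simp: cpf_empty cpf_size_0_iff cconv_empty)

lemma lookup_lin_ext: "lookup (lin_ext \<phi> x) b = (\<Sum>a\<in>keys x. lookup x a * lookup (\<phi> a) b)"
  by (simp add: lin_ext_def lookup_sum lookup_scale)

lemma pq_counit_mult:
  fixes x y :: "('c::finite, 'k::field) pqsym"
  shows "pq_counit (pq_mult x y) = pq_counit x * pq_counit y"
proof -
  have sum_keys: "(\<Sum>a\<in>keys z. lookup z a * (if a = cpf_empty then c else 0)) = lookup z cpf_empty * c"
    for z :: "('c, 'k) pqsym" and c
  proof -
    have "(\<Sum>a\<in>keys z. lookup z a * (if a = cpf_empty then c else 0))
        = (\<Sum>a\<in>keys z. if a = cpf_empty then lookup z cpf_empty * c else 0)"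
      by (intro sum.cong) auto
    thus ?thesis by (simp add: in_keys_iff)
  qed
  have "lookup (\<Sum>r\<in>cconv p q. bas r) cpf_empty =
      (if p = cpf_empty then if q = cpf_empty then 1 else 0 else 0 :: 'k)" for p q :: "'c cpf"
    by (simp add: lookup_sum lookup_bas finite_cconv empty_in_cconv)
  hence "pq_counit (pq_mult x y) = (\<Sum>p\<in>keys x. lookup x p *
      (if p = cpf_empty then \<Sum>q\<in>keys y. lookup y q * (if q = cpf_empty then 1 else 0) else 0))"
    unfolding pq_counit_eq pq_mult_lin_ext lookup_lin_ext by (intro sum.cong) auto
  thus ?thesis by (simp only: sum_keys pq_counit_eq mult_1_right)
qed

lemma bialgebra_pqsym:
  "bialgebra (pq_mult :: ('c::finite, 'k::field) pqsym \<Rightarrow> _) pq_one pq_comult pq_counit"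
proof (intro bialgebra.intro unital_algebra.intro counital_coalgebra.intro bialgebra_axioms.intro)
  show "pq_comult pq_one = (pq_one \<otimes> pq_one :: _ \<Rightarrow>\<^sub>0 'k)"
    by (simp add: pq_one_eq pq_comult_bas breaks_empty lcut_0 rcut_0)
  show "pq_counit pq_one = (1 :: 'k)"
    by (simp add: pq_one_eq pq_counit_bas)
qed (rule linear_pq_mult_left linear_pq_mult_right pq_mult_assoc pq_mult_one_left pq_mult_one_right
    linear_pq_comult linear_pq_counit pq_comult_coassoc pq_counit_left pq_counit_right
    pq_comult_mult pq_counit_mult)+

section \<open>Grading\<close>

lemma pq_component_span: "pq_component n = FV.span (bas ` {p. cpf_size p = n})"
  unfolding pq_component_def by (rule arg_cong[of _ _ FV.span]) blast

lemma pq_component_keys: "pq_component n = {x. keys x \<subseteq> {p. cpf_size p = n}}"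
  unfolding pq_component_span by (rule span_bas)

lemma bas_pq_component: "cpf_size p = n \<Longrightarrow> bas p \<in> pq_component n"
  by (simp add: pq_component_keys)

lemma subspace_pq_component: "FV.subspace (pq_component n)"
  unfolding pq_component_def by (rule FV.subspace_span)

lemma lin_ext_in_subspace:
  "FV.subspace U \<Longrightarrow> (\<And>a. a \<in> keys x \<Longrightarrow> \<phi> a \<in> U) \<Longrightarrow> lin_ext \<phi> x \<in> U"
  unfolding lin_ext_def by (intro FV.subspace_sum FV.subspace_scale) auto

lemma graded_connected_pqsym:
  "graded_connected_bialgebra (pq_mult :: ('c::finite, 'k::field) pqsym \<Rightarrow> _)
    pq_one pq_comult pq_counit pq_component"
proof (intro graded_connected_bialgebra.intro bialgebra_pqsym graded_connected_bialgebra_axioms.intro)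
  fix n :: nat and x :: "('c, 'k) pqsym"
  show "FV.subspace (pq_component n :: ('c, 'k) pqsym set)" by (rule subspace_pq_component)
  show "\<exists>!c. finite {n. c n \<noteq> 0} \<and> (\<forall>n. c n \<in> pq_component n) \<and> x = (\<Sum>n | c n \<noteq> 0. c n)"
    unfolding pq_component_keys mem_Collect_eq by (rule free_direct_sum)
  show "(pq_one :: ('c, 'k) pqsym) \<in> pq_component 0"
    unfolding pq_one_eq by (rule bas_pq_component[OF cpf_empty(2)])
  show "(pq_component 0 :: ('c, 'k) pqsym set) = FV.span {pq_one}"
    by (simp add: pq_component_span cpf_size_0_iff pq_one_eq)
  assume x: "x \<in> pq_component n"
  show "pq_comult x \<in> FV.span {y \<otimes> z | y z i j. i + j = n \<and> y \<in> pq_component i \<and> z \<in> pq_component j}"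
    (is "_ \<in> FV.span ?T")
    unfolding pq_comult_eq
  proof (rule lin_ext_in_subspace)
    fix p assume "p \<in> keys x"
    with x have p: "cpf_size p = n" by (auto simp: pq_component_keys)
    have "bas (lcut k p) \<otimes> bas (rcut k p) \<in> ?T" if "k \<in> breaks p" for k
    proof -
      have "k + (n - k) = n" using breaks_le[OF that] p by simp
      moreover have "bas (lcut k p) \<in> pq_component k" "bas (rcut k p) \<in> pq_component (n - k)"
        by (simp_all add: bas_pq_component size_lcut size_rcut that p)
      ultimately show ?thesis by blast
    qed
    hence "pq_comult (bas p) \<in> FV.span ?T"
      unfolding pq_comult_bas by (intro FV.span_sum FV.span_base)
    thus "cut_sum p \<in> FV.span ?T" by (simp add: pq_comult_eq)
  qed (rule FV.subspace_span)
  { assume "n \<noteq> 0"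
    with x have "cpf_empty \<notin> keys x" by (auto simp: pq_component_keys cpf_empty)
    thus "pq_counit x = 0" by (simp add: pq_counit_eq in_keys_iff) }
next
  fix m n :: nat and x y :: "('c, 'k) pqsym"
  assume x: "x \<in> pq_component m" and y: "y \<in> pq_component n"
  have "bas r \<in> (pq_component (m + n) :: ('c, 'k) pqsym set)"
    if "p \<in> keys x" "q \<in> keys y" "r \<in> cconv p q" for p q r
    using that x y by (intro bas_pq_component) (auto simp: pq_component_keys cconv_size subset_eq)
  thus "pq_mult x y \<in> pq_component (m + n)"
    unfolding pq_mult_lin_ext
    by (intro lin_ext_in_subspace subspace_pq_component FV.subspace_sum) auto
qed

section \<open>The antipode\<close>

text \<open>The inverse of the identity for the convolution product is computed by recursion on the size,
  once as a left inverse and once as a right inverse; associativity makes the two agree.\<close>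

function antipode_left :: "'c cpf \<Rightarrow> ('c, 'k::field) pqsym" where
  "antipode_left r = (if cpf_size r = 0 then pq_one else
     - (\<Sum>k\<in>{k \<in> breaks r. k < cpf_size r}. pq_mult (antipode_left (lcut k r)) (bas (rcut k r))))"
  by pat_completeness auto
termination by (relation "measure cpf_size") (auto simp: size_lcut)

function antipode_right :: "'c cpf \<Rightarrow> ('c, 'k::field) pqsym" where
  "antipode_right r = (if cpf_size r = 0 then pq_one else
     - (\<Sum>k\<in>{k \<in> breaks r. 0 < k}. pq_mult (bas (lcut k r)) (antipode_right (rcut k r))))"
  by pat_completeness auto
termination by (relation "measure cpf_size") (auto simp: size_rcut)

declare antipode_left.simps [simp del] antipode_right.simps [simp del]

text \<open>The break \<open>cpf_size r\<close>, left out of the recursion, contributes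
  \<open>antipode_left r\<close> itself and cancels the other terms. For
  \<open>antipode_right\<close> the break 0 has this role.\<close>

lemma antipode_left_breaks:
  "(\<Sum>k\<in>breaks r. pq_mult (antipode_left (lcut k r)) (bas (rcut k r)))
    = (if r = cpf_empty then pq_one else 0)"
proof (cases "r = cpf_empty")
  case True
  thus ?thesis
    by (simp add: breaks_empty lcut_0 rcut_0 antipode_left.simps[of cpf_empty] cpf_empty pq_mult_one_left
        pq_one_eq[symmetric])
next
  case False
  let ?f = "\<lambda>k. pq_mult (antipode_left (lcut k r)) (bas (rcut k r))"
  have "breaks r = insert (cpf_size r) {k \<in> breaks r. k < cpf_size r}"
    using size_breaks[of r] breaks_le[of _ r] by (auto simp: le_less)
  hence "sum ?f (breaks r) = sum ?f (insert (cpf_size r) {k \<in> breaks r. k < cpf_size r})" by simp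
  also have "\<dots> = ?f (cpf_size r) + sum ?f {k \<in> breaks r. k < cpf_size r}"
    by (rule sum.insert) (simp_all add: finite_breaks)
  also have "?f (cpf_size r) = antipode_left r"
    by (simp add: lcut_size rcut_size pq_one_eq[symmetric] pq_mult_one_right)
  also have "antipode_left r = - sum ?f {k \<in> breaks r. k < cpf_size r}"
    using False by (subst antipode_left.simps) (simp add: cpf_size_0_iff)
  finally show ?thesis using False by simp
qed

lemma antipode_right_breaks:
  "(\<Sum>k\<in>breaks r. pq_mult (bas (lcut k r)) (antipode_right (rcut k r)))
    = (if r = cpf_empty then pq_one else 0)"
proof (cases "r = cpf_empty")
  case True
  thus ?thesis
    by (simp add: breaks_empty lcut_0 rcut_0 antipode_right.simps[of cpf_empty] cpf_empty pq_mult_one_right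
        pq_one_eq[symmetric])
next
  case False
  let ?f = "\<lambda>k. pq_mult (bas (lcut k r)) (antipode_right (rcut k r))"
  have "breaks r = insert 0 {k \<in> breaks r. 0 < k}"
    using zero_breaks[of r] by auto
  hence "sum ?f (breaks r) = sum ?f (insert 0 {k \<in> breaks r. 0 < k})" by simp
  also have "\<dots> = ?f 0 + sum ?f {k \<in> breaks r. 0 < k}"
    by (rule sum.insert) (simp_all add: finite_breaks)
  also have "?f 0 = antipode_right r"
    by (simp add: lcut_0 rcut_0 pq_one_eq[symmetric] pq_mult_one_left)
  also have "antipode_right r = - sum ?f {k \<in> breaks r. 0 < k}"
    using False by (subst antipode_right.simps) (simp add: cpf_size_0_iff)
  finally show ?thesis using False by simp
qed

text \<open>A left inverse S and a right inverse T of the identity agree: S = S * (id * T) = (S *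
  id) * T = T for the convolution of linear maps, evaluated at a basis element.\<close>

lemma antipode_left_eq_right:
  fixes r :: "'c::finite cpf"
  shows "antipode_left r = (antipode_right r :: ('c, 'k::field) pqsym)"
proof -
  let ?S = "antipode_left :: 'c cpf \<Rightarrow> ('c, 'k) pqsym" and ?T = "antipode_right :: 'c cpf \<Rightarrow> ('c, 'k) pqsym"
  have mult_if_right: "pq_mult x (if b then pq_one else 0) = (if b then x else 0)"
    and mult_if_left: "pq_mult (if b then pq_one else 0) x = (if b then x else 0)"
    for b and x :: "('c, 'k) pqsym"
    by (simp_all add: pq_mult_one_left pq_mult_one_right linear_map_0[OF linear_pq_mult_left]
        linear_map_0[OF linear_pq_mult_right])
  have "?S r = (\<Sum>k\<in>breaks r. pq_mult (?S (lcut k r)) (if rcut k r = cpf_empty then pq_one else 0))"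
    unfolding mult_if_right by (simp add: sum_breaks_rcut_empty lcut_size)
  also have "\<dots> = (\<Sum>k\<in>breaks r. \<Sum>i\<in>breaks (rcut k r).
      pq_mult (?S (lcut k r)) (pq_mult (bas (lcut i (rcut k r))) (?T (rcut i (rcut k r)))))"
    by (simp only: antipode_right_breaks[symmetric] linear_map_sum[OF linear_pq_mult_right])
  also have "\<dots> = (\<Sum>k\<in>breaks r. \<Sum>j\<in>breaks (lcut k r).
      pq_mult (?S (lcut j (lcut k r))) (pq_mult (bas (rcut j (lcut k r))) (?T (rcut k r))))"
    by (rule sum_breaks_assoc[symmetric])
  also have "\<dots> = (\<Sum>k\<in>breaks r. pq_mult (if lcut k r = cpf_empty then pq_one else 0) (?T (rcut k r)))"
    by (simp only: antipode_left_breaks[symmetric] linear_map_sum[OF linear_pq_mult_left] pq_mult_assoc)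
  also have "\<dots> = ?T r"
    unfolding mult_if_left by (simp add: sum_breaks_lcut_empty rcut_0)
  finally show ?thesis .
qed

lemma hopf_pqsym:
  "hopf_algebra (pq_mult :: ('c::finite, 'k::field) pqsym \<Rightarrow> _) pq_one pq_comult pq_counit"
proof (intro hopf_algebra.intro bialgebra_pqsym hopf_algebra_axioms.intro exI conjI allI)
  let ?S = "lin_ext antipode_left :: ('c, 'k) pqsym \<Rightarrow> ('c, 'k) pqsym"
  show "linear_map ?S" by (rule lin_ext_linear)
  have lin: "linear_map (\<lambda>x. scale (pq_counit x) pq_one :: ('c, 'k) pqsym)"
    by (rule linear_mapI) (simp_all add: pq_counit_eq lookup_add lookup_scale FV.scale_left_distrib)
  fix x :: "('c, 'k) pqsym"
  show "lin_ext (\<lambda>(a, b). pq_mult (?S (bas a)) (bas b)) (pq_comult x) = scale (pq_counit x) pq_one"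
    by (rule linear_map_eqI[OF linear_map_compose[OF lin_ext_linear linear_pq_comult] lin])
       (simp add: pq_comult_bas_pair linear_map_sum[OF lin_ext_linear] antipode_left_breaks pq_counit_bas)
  show "lin_ext (\<lambda>(a, b). pq_mult (bas a) (?S (bas b))) (pq_comult x) = scale (pq_counit x) pq_one"
    by (rule linear_map_eqI[OF linear_map_compose[OF lin_ext_linear linear_pq_comult] lin])
       (simp add: pq_comult_bas_pair linear_map_sum[OF lin_ext_linear] antipode_left_eq_right
         antipode_right_breaks pq_counit_bas)
qed

theorem theorem7p1:
  shows "(\<forall>f :: ('c::finite, 'k::field) pqsym. \<exists>!t. realize_tensor t = realize_sum f) \<and>
    graded_connected_bialgebra (pq_mult :: ('c, 'k) pqsym \<Rightarrow> _) pq_one pq_comult pq_counit pq_component \<and>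
    hopf_algebra (pq_mult :: ('c, 'k) pqsym \<Rightarrow> _) pq_one pq_comult pq_counit \<and>
    (\<forall>r :: 'c cpf.
       (pq_comult (G r) :: 'c cpf \<times> 'c cpf \<Rightarrow>\<^sub>0 'k) =
         (\<Sum>(p, q) | r \<in> shifted_shuffle p q. G p \<otimes> G q))"
proof (intro conjI allI graded_connected_pqsym hopf_pqsym)
  fix f :: "('c, 'k) pqsym"
  show "\<exists>!t. realize_tensor t = realize_sum f"
    \<comment> \<open>Rewriting leaves the unique existence of a \<open>t\<close> equal to
      \<open>lin_ext cut_sum f\<close>.\<close>
    unfolding realize_tensor_cut_sum[symmetric] realize_tensor_inject by blast
next
  fix r :: "'c cpf"
  show "(pq_comult (G r) :: 'c cpf \<times> 'c cpf \<Rightarrow>\<^sub>0 'k) =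
      (\<Sum>(p, q) | r \<in> shifted_shuffle p q. G p \<otimes> G q)"
    unfolding shifted_shuffle_cuts by (simp add: sum.reindex[OF inj_on_cuts] pq_comult_bas)
qed

end
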